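(* Let $\Omega=(-\infty,+\infty)\setminus\{0\}$ and let $\mathfrak{D}_{\min}$ be the operator $\mathfrak{D}_{\min}\psi=i\psi'$ ($x\neq0$) in $L_2(-\infty,+\infty)$ with domain $\{\psi\in W_2^1(\Omega):\ \psi(-0)=0,\ \psi(+0)=0\}$, and let $\mathfrak{D}_{\max}\psi=i\psi'$ ($x\ne 0$) with domain $W_2^1(\Omega)$. A self-adjoint operator $A$ in $L_2(-\infty,+\infty)$ is an extension of $\mathfrak{D}_{\min}$ if and only if $A$ is the restriction of $\mathfrak{D}_{\max}$ to a set of the form $$\{\psi\in W_2^1(\Omega):\ \psi(+0)=e^{i\alpha}\psi(-0)\}$$ for some real number $\alpha$. Each $\alpha\in[0,2\pi)$ defines such a self-adjoint extension, denoted $\mathfrak{D}_\alpha$. For nonreal $z$, the resolvent $(\mathfrak{D}_\alpha-zI)^{-1}$ is the integral operator $$(\mathfrak{D}_\alpha-zI)^{-1}h(x)=\int_{-\infty}^{\infty}\mathcal{G}_z(x,y;\alpha)h(y)\,dy,\qquad \mathcal{G}_z(x,y;\alpha)=g_z(x-y)+g_z(x)\,\beta(z,\alpha)\,\overline{g_{\bar z}(y)},$$ where $g_z(x)=i\,\mathrm{sign}(\mathrm{Im}\, z)\,\theta(-x\,\mathrm{Im}\, z)\,e^{-izx}$ and $$\beta(z,\alpha)=i(1-e^{-i\alpha})\theta(\mathrm{Im}\, z)+i(e^{i\alpha}-1)\theta(-\mathrm{Im}\, z),$$ and moreover $\overline{\beta(\bar z,\alpha)}=\beta(z,\alpha)$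.
   Context: $\theta$ denotes the Heaviside function ($\theta(t)=1$ for $t>0$, $0$ for $t<0$). $W_2^1(\Omega)$ is the space of functions on $\Omega=\mathbb{R}\setminus\{0\}$ whose restrictions to $(-\infty,0)$ and $(0,\infty)$ lie in the Sobolev spaces $W_2^1$ of these half-lines; $\psi(\pm0)$ denote the one-sided limits at $0$. *)

theory Defs
  imports "HOL-Analysis.Analysis"
begin

text \<open>Functions on the real line are of type real \<Rightarrow> complex.
  Elements of L2(R) are represented by square-integrable functions; an operator in
  L2(R) is represented by its graph, a set of pairs of L2 functions, understood
  modulo equality almost everywhere.\<close>

definition L2 :: "(real \<Rightarrow> complex) \<Rightarrow> bool" where
  "L2 f \<longleftrightarrow> f \<in> borel_measurable lborel \<and> integrable lborel (\<lambda>x. (cmod (f x))\<^sup>2)"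

definition ae_eq :: "(real \<Rightarrow> complex) \<Rightarrow> (real \<Rightarrow> complex) \<Rightarrow> bool" where
  "ae_eq f g \<longleftrightarrow> (AE x in lborel. f x = g x)"

definition l2_inner :: "(real \<Rightarrow> complex) \<Rightarrow> (real \<Rightarrow> complex) \<Rightarrow> complex" where
  "l2_inner f g = (LINT x|lborel. f x * cnj (g x))"

definition adjoint_graph :: "((real \<Rightarrow> complex) \<times> (real \<Rightarrow> complex)) set
    \<Rightarrow> ((real \<Rightarrow> complex) \<times> (real \<Rightarrow> complex)) set" where
  "adjoint_graph A = {(u, v). L2 u \<and> L2 v \<and> (\<forall>(f, g) \<in> A. l2_inner g u = l2_inner f v)}"

text \<open>A self-adjoint operator: single-valued (modulo a.e. equality) and equal to its adjoint.
  (Single-valuedness of A = A* is equivalent to dense domain.)\<close>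
definition self_adjoint :: "((real \<Rightarrow> complex) \<times> (real \<Rightarrow> complex)) set \<Rightarrow> bool" where
  "self_adjoint A \<longleftrightarrow>
     (\<forall>f g g'. (f, g) \<in> A \<longrightarrow> (f, g') \<in> A \<longrightarrow> ae_eq g g') \<and> adjoint_graph A = A"

text \<open>psi is (the continuous-on-each-half-line representative of) an element of
  W_2^1(Omega), Omega = R \ {0}, with derivative phi on Omega.\<close>
definition W21_Omega :: "(real \<Rightarrow> complex) \<Rightarrow> (real \<Rightarrow> complex) \<Rightarrow> bool" where
  "W21_Omega psi phi \<longleftrightarrow> L2 psi \<and> L2 phi \<and>
     (\<forall>a b. 0 < a \<and> a \<le> b \<longrightarrow> (phi has_integral (psi b - psi a)) {a..b}) \<and>
     (\<forall>a b. a \<le> b \<and> b < 0 \<longrightarrow> (phi has_integral (psi b - psi a)) {a..b})"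

definition lim_plus0 :: "(real \<Rightarrow> complex) \<Rightarrow> complex" where
  "lim_plus0 psi = Lim (at_right 0) psi"

definition lim_minus0 :: "(real \<Rightarrow> complex) \<Rightarrow> complex" where
  "lim_minus0 psi = Lim (at_left 0) psi"

definition D_graph :: "((real \<Rightarrow> complex) \<Rightarrow> bool)
    \<Rightarrow> ((real \<Rightarrow> complex) \<times> (real \<Rightarrow> complex)) set" where
  "D_graph S = {(f, g). L2 f \<and> L2 g \<and>
     (\<exists>psi phi. W21_Omega psi phi \<and> S psi \<and> ae_eq f psi \<and> ae_eq g (\<lambda>x. \<i> * phi x))}"

definition D_max where "D_max = D_graph (\<lambda>_. True)"

definition D_min where
  "D_min = D_graph (\<lambda>psi. lim_minus0 psi = 0 \<and> lim_plus0 psi = 0)"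

definition D_alpha :: "real \<Rightarrow> ((real \<Rightarrow> complex) \<times> (real \<Rightarrow> complex)) set" where
  "D_alpha \<alpha> = D_graph (\<lambda>psi. lim_plus0 psi = exp (\<i> * of_real \<alpha>) * lim_minus0 psi)"

text \<open>Heaviside function; the value at 0 is immaterial, we take 0.\<close>
definition heaviside :: "real \<Rightarrow> real" where
  "heaviside t = (if t > 0 then 1 else 0)"

definition g_fun :: "complex \<Rightarrow> real \<Rightarrow> complex" where
  "g_fun z x = \<i> * of_real (sgn (Im z)) * of_real (heaviside (- x * Im z))
                 * exp (- \<i> * z * of_real x)"

definition beta_fun :: "complex \<Rightarrow> real \<Rightarrow> complex" where
  "beta_fun z \<alpha> = \<i> * (1 - exp (- \<i> * of_real \<alpha>)) * of_real (heaviside (Im z))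
                 + \<i> * (exp (\<i> * of_real \<alpha>) - 1) * of_real (heaviside (- Im z))"

definition green :: "complex \<Rightarrow> real \<Rightarrow> real \<Rightarrow> real \<Rightarrow> complex" where
  "green z \<alpha> x y = g_fun z (x - y) + g_fun z x * beta_fun z \<alpha> * cnj (g_fun (cnj z) y)"

end

theory Submission
  imports Defs
begin

text \<open>Green's identity for two elements of \<open>W\<^sub>2\<^sup>1(\<Omega>)\<close> leaves only the boundary term
  \<open>\<i> (\<psi>\<^sub>1(-0) cnj \<psi>\<^sub>2(-0) - \<psi>\<^sub>1(+0) cnj \<psi>\<^sub>2(+0))\<close>, so each \<open>D\<^sub>\<alpha>\<close> is symmetric.
  For nonreal \<open>z\<close> the Green function maps \<open>L\<^sub>2\<close> into the domain of \<open>D\<^sub>\<alpha>\<close> (Young's inequality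
  for the \<open>L\<^sub>1\<close> kernel, and the product rule for \<open>exp (-\<i> z x)\<close> times an indefinite integral)
  and solves \<open>(D\<^sub>\<alpha> - z) u = h\<close>. Symmetry and surjectivity of \<open>D\<^sub>\<alpha> \<plusminus> \<i>\<close> give self-adjointness,
  and symmetry with surjectivity of \<open>D\<^sub>\<alpha> - cnj z\<close> gives uniqueness of the solution.
  The same argument for \<open>D_min\<close>, for which the range of \<open>D_min + \<i>\<close> is the orthogonal complement of \<open>g_fun \<i>\<close>,
  shows that the adjoint of \<open>D_min\<close> lies in \<open>D_max\<close>. Hence a self-adjoint extension \<open>A\<close> of \<open>D_min\<close>
  is contained in \<open>D_max\<close>, and the boundary form vanishes on \<open>A\<close>; this forces
  \<open>\<psi>(+0) = exp (\<i> \<alpha>) \<psi>(-0)\<close> with one \<open>\<alpha>\<close> for all of \<open>A\<close>, so \<open>A \<subseteq> D\<^sub>\<alpha>\<close> and, by taking adjoints, equality.\<close>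

section \<open>Indefinite integrals on the line\<close>

text \<open>Integration by parts for primitives, with no pointwise derivative involved: the integral
  of \<open>F s * G t\<close> over the plane is split along the diagonal, and Fubini is applied to
  each triangle.\<close>

lemma Fubini_triangle:
  fixes F G :: "real \<Rightarrow> complex"
  assumes F: "integrable lborel F" and G: "integrable lborel G"
  shows "integrable lborel (\<lambda>s. F s * (LINT t:{..s}|lborel. G t))"
    and "integrable lborel (\<lambda>t. G t * (LINT s:{..t}|lborel. F s))"
    and "(LINT s|lborel. F s * (LINT t:{..s}|lborel. G t)) +
         (LINT t|lborel. G t * (LINT s:{..t}|lborel. F s)) = (LINT s|lborel. F s) * (LINT t|lborel. G t)"
proof -
  have [measurable]: "F \<in> borel_measurable borel" "G \<in> borel_measurable borel"
    using F G by (auto dest: borel_measurable_integrable)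
  have FG: "integrable (lborel \<Otimes>\<^sub>M lborel) (\<lambda>(s, t). F s * G t)"
  proof (rule lborel_pair.Fubini_integrable)
    show "(\<lambda>(s, t). F s * G t) \<in> borel_measurable (lborel \<Otimes>\<^sub>M lborel)" by measurable
    show "integrable lborel (\<lambda>s. LINT t|lborel. norm (case (s, t) of (s, t) \<Rightarrow> F s * G t))"
      using F by (simp add: norm_mult)
    show "AE s in lborel. integrable lborel (\<lambda>t. case (s, t) of (s, t) \<Rightarrow> F s * G t)"
      using G by simp
  qed
  define J1 where "J1 = (\<lambda>s t. indicator {(s, t). t \<le> s} (s, t) *\<^sub>R (F s * G t))"
  define J2 where "J2 = (\<lambda>s t. indicator {(s, t). s \<le> t} (s, t) *\<^sub>R (F s * G t))"
  have m: "{(s, t::real). t \<le> s} \<in> sets (lborel \<Otimes>\<^sub>M lborel)" "{(s, t::real). s \<le> t} \<in> sets (lborel \<Otimes>\<^sub>M lborel)"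
    unfolding lborel_prod sets_lborel case_prod_unfold
    by (intro borel_closed closed_Collect_le continuous_intros)+
  have J1: "integrable (lborel \<Otimes>\<^sub>M lborel) (case_prod J1)"
    and J2: "integrable (lborel \<Otimes>\<^sub>M lborel) (case_prod J2)"
    using integrable_mult_indicator[OF m(1) FG] integrable_mult_indicator[OF m(2) FG]
    by (simp_all add: J1_def J2_def case_prod_unfold)
  have i1: "(LINT t|lborel. J1 s t) = F s * (LINT t:{..s}|lborel. G t)" for s
  proof -
    have "(LINT t|lborel. J1 s t) = F s * (LINT t|lborel. indicator {..s} t *\<^sub>R G t)"
      unfolding integral_mult_right_zero[symmetric]
      by (intro Bochner_Integration.integral_cong) (auto simp: J1_def indicator_def)
    then show ?thesis by (simp add: set_lebesgue_integral_def)
  qed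
  have i2: "(LINT s|lborel. J2 s t) = G t * (LINT s:{..t}|lborel. F s)" for t
  proof -
    have "(LINT s|lborel. J2 s t) = G t * (LINT s|lborel. indicator {..t} s *\<^sub>R F s)"
      unfolding integral_mult_right_zero[symmetric]
      by (intro Bochner_Integration.integral_cong) (auto simp: J2_def indicator_def)
    then show ?thesis by (simp add: set_lebesgue_integral_def)
  qed
  show "integrable lborel (\<lambda>s. F s * (LINT t:{..s}|lborel. G t))"
    using lborel_pair.integrable_fst[OF J1] by (simp add: i1)
  show "integrable lborel (\<lambda>t. G t * (LINT s:{..t}|lborel. F s))"
    using lborel_pair.integrable_snd[OF J2] by (simp add: i2)
  \<comment> \<open>The triangles overlap only on the diagonal, which meets each line of fixed
    \<open>s\<close> in a single point.\<close>
  have ae: "AE p in lborel \<Otimes>\<^sub>M lborel. case_prod J1 p + case_prod J2 p = (case p of (s, t) \<Rightarrow> F s * G t)"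
  proof (rule lborel_pair.AE_pair_measure)
    show "{x \<in> space (lborel \<Otimes>\<^sub>M lborel). case_prod J1 x + case_prod J2 x = (case x of (s, t) \<Rightarrow> F s * G t)} \<in> sets (lborel \<Otimes>\<^sub>M lborel)"
      using J1[THEN borel_measurable_integrable] J2[THEN borel_measurable_integrable] FG[THEN borel_measurable_integrable]
      by measurable
    show "AE x in lborel. AE y in lborel. case_prod J1 (x, y) + case_prod J2 (x, y) = (case (x, y) of (s, t) \<Rightarrow> F s * G t)"
    proof (rule AE_I2)
      fix x :: real
      have "AE y in lborel. y \<noteq> x" by (rule AE_lborel_singleton)
      then show "AE y in lborel. case_prod J1 (x, y) + case_prod J2 (x, y) = (case (x, y) of (s, t) \<Rightarrow> F s * G t)"
        by eventually_elim (auto simp: J1_def J2_def indicator_def)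
    qed
  qed
  have "(LINT s|lborel. F s * (LINT t:{..s}|lborel. G t)) +
         (LINT t|lborel. G t * (LINT s:{..t}|lborel. F s)) 
      = (LINT p|(lborel \<Otimes>\<^sub>M lborel). case_prod J1 p) + (LINT p|(lborel \<Otimes>\<^sub>M lborel). case_prod J2 p)"
    using lborel_pair.integral_fst[OF J1] lborel_pair.integral_snd[OF J2] by (simp add: i1 i2)
  also have "\<dots> = (LINT p|(lborel \<Otimes>\<^sub>M lborel). case_prod J1 p + case_prod J2 p)"
    using J1 J2 by simp
  also have "\<dots> = (LINT p|(lborel \<Otimes>\<^sub>M lborel). (case p of (s, t) \<Rightarrow> F s * G t))"
    using ae J1 J2 FG by (intro integral_cong_AE) (auto dest: borel_measurable_integrable)
  also have "\<dots> = (LINT s|lborel. (LINT t|lborel. F s * G t))"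
    using lborel_pair.integral_fst[OF FG] by simp
  also have "\<dots> = (LINT s|lborel. F s) * (LINT t|lborel. G t)" by simp
  finally show "(LINT s|lborel. F s * (LINT t:{..s}|lborel. G t)) +
         (LINT t|lborel. G t * (LINT s:{..t}|lborel. F s)) = (LINT s|lborel. F s) * (LINT t|lborel. G t)" .
qed

text \<open>\<open>Fubini_triangle\<close> is applied to \<open>f'\<close> and \<open>g'\<close>
  extended by zero outside \<open>{a..b}\<close>; on the interval the primitives of these extensions
  are \<open>f x - f a\<close> and \<open>g x - g a\<close>.\<close>

lemma product_rule_integral:
  fixes f g f' g' :: "real \<Rightarrow> complex"
  assumes ab: "a \<le> b"
    and f': "set_integrable lborel {a..b} f'" and g': "set_integrable lborel {a..b} g'"
    and f: "\<And>x. a \<le> x \<Longrightarrow> x \<le> b \<Longrightarrow> (LINT t:{a..x}|lborel. f' t) = f x - f a"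
    and g: "\<And>x. a \<le> x \<Longrightarrow> x \<le> b \<Longrightarrow> (LINT t:{a..x}|lborel. g' t) = g x - g a"
  shows "set_integrable lborel {a..b} (\<lambda>x. f' x * g x + f x * g' x)"
    and "(LINT x:{a..b}|lborel. f' x * g x + f x * g' x) = f b * g b - f a * g a"
proof -
  define F where "F = (\<lambda>x. indicator {a..b} x *\<^sub>R f' x)"
  define G where "G = (\<lambda>x. indicator {a..b} x *\<^sub>R g' x)"
  have F: "integrable lborel F" and G: "integrable lborel G"
    using f' g' by (simp_all add: F_def G_def set_integrable_def)
  have PF: "(LINT t:{..x}|lborel. F t) = f x - f a" if "x \<in> {a..b}" for x
  proof -
    have "(LINT t:{..x}|lborel. F t) = (LINT t:{a..x}|lborel. f' t)"
      unfolding set_lebesgue_integral_def F_def using that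
      by (intro Bochner_Integration.integral_cong) (auto simp: indicator_def)
    then show ?thesis using f that by simp
  qed
  have PG: "(LINT t:{..x}|lborel. G t) = g x - g a" if "x \<in> {a..b}" for x
  proof -
    have "(LINT t:{..x}|lborel. G t) = (LINT t:{a..x}|lborel. g' t)"
      unfolding set_lebesgue_integral_def G_def using that
      by (intro Bochner_Integration.integral_cong) (auto simp: indicator_def)
    then show ?thesis using g that by simp
  qed
  have IF: "(LINT t|lborel. F t) = f b - f a" and IG: "(LINT t|lborel. G t) = g b - g a"
    using f[OF ab] g[OF ab] by (simp_all add: F_def G_def set_lebesgue_integral_def)
  have e1: "F s * (LINT t:{..s}|lborel. G t) = indicator {a..b} s *\<^sub>R (f' s * (g s - g a))" for s
    using PG[of s] by (auto simp: F_def indicator_def)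
  have e2: "G s * (LINT t:{..s}|lborel. F t) = indicator {a..b} s *\<^sub>R (g' s * (f s - f a))" for s
    using PF[of s] by (auto simp: G_def indicator_def)
  note T = Fubini_triangle[OF F G, unfolded e1 e2 IF IG]
  \<comment> \<open>The constants \<open>g a\<close> and \<open>f a\<close>, absent from the
    primitives, return as multiples of \<open>F\<close> and \<open>G\<close>.\<close>
  have eq: "indicator {a..b} x *\<^sub>R (f' x * g x + f x * g' x) =
     indicator {a..b} x *\<^sub>R (f' x * (g x - g a)) + indicator {a..b} x *\<^sub>R (g' x * (f x - f a))
       + g a * F x + f a * G x" for x
    by (auto simp: F_def G_def indicator_def algebra_simps)
  show "set_integrable lborel {a..b} (\<lambda>x. f' x * g x + f x * g' x)"
    unfolding set_integrable_def eq using T F G by (intro Bochner_Integration.integrable_add) auto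
  have "(LINT x:{a..b}|lborel. f' x * g x + f x * g' x)
     = (f b - f a) * (g b - g a) + g a * (f b - f a) + f a * (g b - g a)"
    unfolding set_lebesgue_integral_def eq using T F G by (simp add: IF IG)
  then show "(LINT x:{a..b}|lborel. f' x * g x + f x * g' x) = f b * g b - f a * g a"
    by (simp add: algebra_simps)
qed

lemma set_integral_atMost_diff:
  fixes r :: "real \<Rightarrow> complex"
  assumes r: "integrable lborel r" and ab: "a \<le> b"
  shows "(LINT t:{..b}|lborel. r t) - (LINT t:{..a}|lborel. r t) = (LINT t:{a..b}|lborel. r t)"
proof -
  have i: "set_integrable lborel A r" if "A \<in> sets borel" for A
    using that r by (simp add: set_integrable_def integrable_mult_indicator)
  have m: "r \<in> borel_measurable borel" using r by (auto dest: borel_measurable_integrable)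
  have "(LINT t:{..b}|lborel. r t) = (LINT t:{..a} \<union> {a<..b}|lborel. r t)"
    using ab by (simp add: ivl_disj_un)
  also have "\<dots> = (LINT t:{..a}|lborel. r t) + (LINT t:{a<..b}|lborel. r t)"
    by (intro set_integral_Un i) auto
  also have "(LINT t:{a<..b}|lborel. r t) = (LINT t:{a..b}|lborel. r t)"
  proof -
    have "AE x in lborel. x \<noteq> a" by (rule AE_lborel_singleton)
    then have "AE x in lborel. indicator {a<..b} x *\<^sub>R r x = indicator {a..b} x *\<^sub>R r x"
      by eventually_elim (auto simp: indicator_def)
    then show ?thesis
      unfolding set_lebesgue_integral_def using m by (intro integral_cong_AE) auto
  qed
  finally show ?thesis by simp
qed

text \<open>Dominated convergence with majorant \<open>norm (r t)\<close>: the indicators of the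
  half-lines converge at every \<open>t\<close> other than \<open>x\<close>.\<close>

lemma isCont_set_integral_atMost:
  fixes r :: "real \<Rightarrow> complex"
  assumes r: "integrable lborel r"
  shows "isCont (\<lambda>x. LINT t:{..x}|lborel. r t) x"
  unfolding continuous_at_sequentially
proof (intro allI impI)
  fix X assume X: "X \<longlonglongrightarrow> x"
  have m[measurable]: "r \<in> borel_measurable borel" using r by (auto dest: borel_measurable_integrable)
  show "((\<lambda>x. LINT t:{..x}|lborel. r t) \<circ> X) \<longlonglongrightarrow> (LINT t:{..x}|lborel. r t)"
    unfolding set_lebesgue_integral_def o_def
  proof (rule integral_dominated_convergence[where w="\<lambda>t. norm (r t)"])
    have "AE t in lborel. t \<noteq> x" by (rule AE_lborel_singleton)
    then show "AE t in lborel. (\<lambda>i. indicat_real {..X i} t *\<^sub>R r t) \<longlonglongrightarrow> indicat_real {..x} t *\<^sub>R r t"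
    proof eventually_elim
      case (elim t)
      have "\<forall>\<^sub>F i in sequentially. indicat_real {..X i} t *\<^sub>R r t = indicat_real {..x} t *\<^sub>R r t"
      proof (cases "t < x")
        case True
        from order_tendstoD(1)[OF X this] show ?thesis
          by eventually_elim (use True in \<open>auto simp: indicator_def\<close>)
      next
        case False
        with elim have "x < t" by simp
        from order_tendstoD(2)[OF X this] show ?thesis
          by eventually_elim (use \<open>x < t\<close> in \<open>auto simp: indicator_def\<close>)
      qed
      then show ?case by (rule tendsto_eventually)
    qed
  qed (use r in \<open>auto simp: indicator_def\<close>)
qed

lemma tendsto_set_integral_atMost:
  fixes r :: "real \<Rightarrow> complex"
  assumes r: "integrable lborel r"
  shows "((\<lambda>x. LINT t:{..x}|lborel. r t) \<longlongrightarrow> (LINT t|lborel. r t)) at_top"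
    and "((\<lambda>x. LINT t:{..x}|lborel. r t) \<longlongrightarrow> 0) at_bot"
proof -
  show "((\<lambda>x. LINT t:{..x}|lborel. r t) \<longlongrightarrow> (LINT t|lborel. r t)) at_top"
    unfolding set_lebesgue_integral_def by (rule tendsto_integral_at_top[OF _ r]) simp
  have m[measurable]: "r \<in> borel_measurable borel" using r by (auto dest: borel_measurable_integrable)
  show "((\<lambda>x. LINT t:{..x}|lborel. r t) \<longlongrightarrow> 0) at_bot"
  proof (rule tendsto_at_botI_sequentially)
    fix X :: "nat \<Rightarrow> real" assume X: "filterlim X at_bot sequentially"
    have "(\<lambda>n. LINT t:{..X n}|lborel. r t) \<longlonglongrightarrow> (LINT t|(lborel::real measure). (0::complex))"
      unfolding set_lebesgue_integral_def
    proof (rule integral_dominated_convergence[where w="\<lambda>t. norm (r t)"])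
      show "AE t in lborel. (\<lambda>i. indicat_real {..X i} t *\<^sub>R r t) \<longlonglongrightarrow> 0"
      proof (rule AE_I2)
        fix t
        have "eventually (\<lambda>n. X n \<le> t - 1) sequentially"
          using X unfolding filterlim_at_bot by auto
        then have "\<forall>\<^sub>F i in sequentially. indicat_real {..X i} t *\<^sub>R r t = 0"
          by eventually_elim (auto simp: indicator_def)
        then show "(\<lambda>i. indicat_real {..X i} t *\<^sub>R r t) \<longlonglongrightarrow> 0" by (rule tendsto_eventually)
      qed
    qed (use r in \<open>auto simp: indicator_def\<close>)
    then show "(\<lambda>n. LINT t:{..X n}|lborel. r t) \<longlonglongrightarrow> 0" by simp
  qed
qed

text \<open>Half-lines form an intersection-stable generator of the Borel sets, and vanishing of the
  integral passes to complements and to countable disjoint unions, hence to all Borel sets.\<close>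

lemma set_integral_atMost_zero_imp_AE_zero:
  fixes r :: "real \<Rightarrow> complex"
  assumes r: "integrable lborel r" and z: "\<And>x. (LINT t:{..x}|lborel. r t) = 0"
  shows "AE x in lborel. r x = 0"
proof (rule sigma_finite_measure.density_zero[OF sigma_finite_lborel r])
  fix A :: "real set" assume "A \<in> sets lborel"
  then have A: "A \<in> sigma_sets UNIV (range atMost)"
    by (simp add: borel_eq_atMost sets_measure_of)
  have i: "set_integrable lborel A r" if "A \<in> sigma_sets UNIV (range atMost)" for A
    using that r by (simp add: set_integrable_def integrable_mult_indicator borel_eq_atMost sets_measure_of)
  \<comment> \<open>The total integral is a limit of half-line integrals; its vanishing is what the
    complement case rests on.\<close>
  have tot: "(LINT t|lborel. r t) = 0"
    using tendsto_set_integral_atMost(1)[OF r] by (auto simp: z tendsto_const_iff)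
  have stable: "Int_stable (range atMost :: real set set)"
    by (rule Int_stableI) (auto simp: Int_atMost image_iff)
  have generator: "range atMost \<subseteq> Pow (UNIV :: real set)" by simp
  show "set_lebesgue_integral lborel A r = 0"
  proof (induction rule: sigma_sets_induct_disjoint[OF stable generator A, consumes 0, case_names basic empty compl union])
    case (basic A) then show ?case using z by auto
  next
    case empty show ?case by (simp add: set_lebesgue_integral_def)
  next
    case (compl A)
    have "(LINT t|lborel. r t) = (LINT t:A \<union> (UNIV - A)|lborel. r t)"
      by (simp add: set_lebesgue_integral_def)
    also have "\<dots> = (LINT t:A|lborel. r t) + (LINT t:(UNIV - A)|lborel. r t)"
      using compl(1) by (intro set_integral_Un i) (auto intro: sigma_sets.Compl)
    finally show ?case using tot compl by simp
  next
    case (union A)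
    have s: "A i \<in> sets lborel" for i
      using union(2) by (auto simp: borel_eq_atMost sets_measure_of)
    have "set_lebesgue_integral lborel (\<Union>i. A i) r = (\<Sum>i. set_lebesgue_integral lborel (A i) r)"
    proof (rule lebesgue_integral_countable_add)
      show "set_integrable lborel (\<Union>i. A i) r" using union(2) by (intro i sigma_sets.Union) auto
    qed (use s union(1) in \<open>auto simp: disjoint_family_on_def\<close>)
    then show ?case using union(3) by simp
  qed
qed

text \<open>A nonzero limit would keep \<open>norm (q x)\<close> above \<open>norm L / 2\<close> on
  a whole half-line, whose intervals have arbitrarily large length.\<close>

lemma integrable_tendsto_at_top_zero:
  fixes q :: "real \<Rightarrow> complex"
  assumes q: "integrable lborel q" and lim: "(q \<longlongrightarrow> L) at_top"
  shows "L = 0"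
proof (rule ccontr)
  assume "L \<noteq> 0"
  then have "norm L / 2 < norm L" by simp
  with tendsto_norm[OF lim] have "\<forall>\<^sub>F x in at_top. norm L / 2 < norm (q x)"
    by (rule order_tendstoD(1))
  then obtain N where N: "\<And>x. x \<ge> N \<Longrightarrow> norm L / 2 < norm (q x)"
    by (auto simp: eventually_at_top_linorder)
  have "(norm L / 2) * x \<le> (LINT x|lborel. norm (q x))" if "x > 0" for x
  proof -
    have "(LINT t|lborel. indicator {N..N + x} t * (norm L / 2)) \<le> (LINT x|lborel. norm (q x))"
    proof (rule integral_mono)
      show "integrable lborel (\<lambda>t. indicator {N..N + x} t * (norm L / 2))"
        using that by (intro integrable_mult_left integrable_real_indicator) auto
      show "indicator {N..N + x} t * (norm L / 2) \<le> norm (q t)" for t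
        using N[of t] by (auto simp: indicator_def)
    qed (use q in auto)
    then show ?thesis using that by (simp add: mult.commute)
  qed
  \<comment> \<open>The length is chosen so that the lower bound becomes the integral of
    \<open>norm (q x)\<close> plus 1.\<close>
  from this[of "(2 / norm L) * ((LINT x|lborel. norm (q x)) + 1)"] \<open>L \<noteq> 0\<close>
  show False by (simp add: add_nonneg_pos)
qed

section \<open>Square-integrable functions and Green's identity\<close>

lemma L2_measurable: "L2 f \<Longrightarrow> f \<in> borel_measurable borel"
  by (simp add: L2_def)

lemma L2_square_integrable: "L2 f \<Longrightarrow> integrable lborel (\<lambda>x. (cmod (f x))\<^sup>2)"
  by (simp add: L2_def)

lemma L2_bound:
  assumes "L2 f" "L2 g" "h \<in> borel_measurable borel"
    and "\<And>x. (cmod (h x))\<^sup>2 \<le> C * ((cmod (f x))\<^sup>2 + (cmod (g x))\<^sup>2)"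
  shows "L2 h"
  unfolding L2_def
proof
  show "integrable lborel (\<lambda>x. (cmod (h x))\<^sup>2)"
  proof (rule Bochner_Integration.integrable_bound)
    show "integrable lborel (\<lambda>x. C * ((cmod (f x))\<^sup>2 + (cmod (g x))\<^sup>2))"
      using assms(1,2) by (auto simp: L2_def)
    show "AE x in lborel. norm ((cmod (h x))\<^sup>2) \<le> norm (C * ((cmod (f x))\<^sup>2 + (cmod (g x))\<^sup>2))"
      using assms(4) by (intro AE_I2) (auto intro: order_trans[OF _ abs_ge_self])
  qed (use assms(3) in simp)
qed (use assms(3) in simp)

lemma L2_mult_integrable:
  assumes "L2 f" "L2 g"
  shows "integrable lborel (\<lambda>x. f x * g x)"
proof (rule Bochner_Integration.integrable_bound)
  show "integrable lborel (\<lambda>x. (cmod (f x))\<^sup>2 + (cmod (g x))\<^sup>2)"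
    using assms by (auto simp: L2_def)
  have "cmod (f x * g x) \<le> (cmod (f x))\<^sup>2 + (cmod (g x))\<^sup>2" for x
  proof -
    have "0 \<le> cmod (f x) * cmod (g x)" by simp
    then show ?thesis
      using sum_squares_bound[of "cmod (f x)" "cmod (g x)"] unfolding norm_mult by linarith
  qed
  then show "AE x in lborel. norm (f x * g x) \<le> norm ((cmod (f x))\<^sup>2 + (cmod (g x))\<^sup>2)"
    by (intro AE_I2) simp
qed (use assms[THEN L2_measurable] in simp)

lemma L2_add: assumes "L2 f" "L2 g" shows "L2 (\<lambda>x. f x + g x)"
proof (rule L2_bound[OF assms, where C=2])
  fix x
  have "(cmod (f x + g x))\<^sup>2 \<le> (cmod (f x) + cmod (g x))\<^sup>2"
    by (intro power_mono norm_triangle_ineq) auto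
  also have "\<dots> \<le> 2 * ((cmod (f x))\<^sup>2 + (cmod (g x))\<^sup>2)"
    using sum_squares_bound[of "cmod (f x)" "cmod (g x)"] by (simp add: power2_sum)
  finally show "(cmod (f x + g x))\<^sup>2 \<le> 2 * ((cmod (f x))\<^sup>2 + (cmod (g x))\<^sup>2)" .
qed (use assms[THEN L2_measurable] in simp)

lemma L2_cmult: assumes "L2 f" shows "L2 (\<lambda>x. c * f x)"
  using assms by (auto simp: L2_def norm_mult power_mult_distrib)

lemma L2_uminus: "L2 f \<Longrightarrow> L2 (\<lambda>x. - f x)"
  by (simp add: L2_def)

lemma L2_diff: assumes "L2 f" "L2 g" shows "L2 (\<lambda>x. f x - g x)"
  using L2_add[OF assms(1) L2_uminus[OF assms(2)]] by simp

lemma L2_cnj: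
  assumes "L2 f"
  shows "L2 (\<lambda>x. cnj (f x))"
proof -
  have "cnj \<in> borel_measurable borel"
    by (intro borel_measurable_continuous_onI continuous_intros)
  then show ?thesis
    using assms by (auto simp: L2_def intro: measurable_compose)
qed

lemma L2_zero: "L2 (\<lambda>x. 0)"
  by (simp add: L2_def)

lemma L2_indicator: "L2 (\<lambda>x. indicator {a..b} x)"
proof -
  have "(\<lambda>x. (cmod (indicator {a..b::real} x))\<^sup>2) = indicator {a..b}"
    by (auto simp: indicator_def)
  then show ?thesis by (simp add: L2_def emeasure_lborel_Icc_eq)
qed

lemma L2_set_integrable:
  assumes "L2 f"
  shows "set_integrable lborel {a..b} f"
proof -
  have "(\<lambda>x. indicator {a..b} x *\<^sub>R f x) = (\<lambda>x. indicator {a..b} x * f x)"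
    by (auto simp: indicator_def)
  then show ?thesis
    using L2_mult_integrable[OF L2_indicator assms] by (simp add: set_integrable_def)
qed

text \<open>This trades the gauge integral of \<open>W21_Omega\<close> for the Lebesgue integral: on
  compact intervals an \<open>L2\<close> function is Lebesgue integrable.\<close>

lemma has_integral_L2_iff:
  assumes "L2 f"
  shows "(f has_integral I) {a..b} \<longleftrightarrow> (LINT t:{a..b}|lborel. f t) = I"
  using set_borel_integral_eq_integral[OF L2_set_integrable[OF assms, of a b]]
  by (auto simp: has_integral_integrable_integral)

section \<open>One-sided limits at 0 and Green's identity for \<open>W21_Omega\<close>\<close>

lemma W21_L2: "W21_Omega \<psi> \<phi> \<Longrightarrow> L2 \<psi>" "W21_Omega \<psi> \<phi> \<Longrightarrow> L2 \<phi>"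
  by (auto simp: W21_Omega_def)

lemma W21_Omega_iff:
  "W21_Omega \<psi> \<phi> \<longleftrightarrow> L2 \<psi> \<and> L2 \<phi> \<and>
     (\<forall>a b. a \<le> b \<longrightarrow> 0 < a \<or> b < 0 \<longrightarrow> (LINT t:{a..b}|lborel. \<phi> t) = \<psi> b - \<psi> a)"
  unfolding W21_Omega_def by (auto simp: has_integral_L2_iff)

text \<open>On \<open>(0, c]\<close> the function \<open>q\<close> differs by a constant from the
  primitive of \<open>r\<close>, which is continuous at 0. The limit is written out explicitly so
  that it can be compared with other values later.\<close>

lemma tendsto_from_right:
  fixes q r :: "real \<Rightarrow> complex"
  assumes r: "integrable lborel r" and "c > 0"
    and q: "\<And>a. 0 < a \<Longrightarrow> a \<le> c \<Longrightarrow> q c - q a = (LINT t:{a..c}|lborel. r t)"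
  shows "(q \<longlongrightarrow> q c - (LINT t:{..c}|lborel. r t) + (LINT t:{..0}|lborel. r t)) (at_right 0)"
proof (rule Lim_transform_eventually)
  show "((\<lambda>x. q c - (LINT t:{..c}|lborel. r t) + (LINT t:{..x}|lborel. r t)) \<longlongrightarrow>
      q c - (LINT t:{..c}|lborel. r t) + (LINT t:{..0}|lborel. r t)) (at_right 0)"
    using isCont_set_integral_atMost[OF r, of 0]
    by (intro tendsto_intros) (simp add: isCont_def filterlim_at_split)
  show "\<forall>\<^sub>F x in at_right 0. q c - (LINT t:{..c}|lborel. r t) + (LINT t:{..x}|lborel. r t) = q x"
    using eventually_at_rightI[of 0 c "\<lambda>x. 0 < x \<and> x < c", simplified, OF \<open>c > 0\<close>]
  proof eventually_elim
    case (elim x)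
    then show ?case
      using q[of x] set_integral_atMost_diff[OF r, of x c] by (simp add: algebra_simps)
  qed
qed

lemma tendsto_from_left:
  fixes q r :: "real \<Rightarrow> complex"
  assumes r: "integrable lborel r" and "c < 0"
    and q: "\<And>a. a < 0 \<Longrightarrow> c \<le> a \<Longrightarrow> q a - q c = (LINT t:{c..a}|lborel. r t)"
  shows "(q \<longlongrightarrow> q c - (LINT t:{..c}|lborel. r t) + (LINT t:{..0}|lborel. r t)) (at_left 0)"
proof (rule Lim_transform_eventually)
  show "((\<lambda>x. q c - (LINT t:{..c}|lborel. r t) + (LINT t:{..x}|lborel. r t)) \<longlongrightarrow>
      q c - (LINT t:{..c}|lborel. r t) + (LINT t:{..0}|lborel. r t)) (at_left 0)"
    using isCont_set_integral_atMost[OF r, of 0]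
    by (intro tendsto_intros) (simp add: isCont_def filterlim_at_split)
  show "\<forall>\<^sub>F x in at_left 0. q c - (LINT t:{..c}|lborel. r t) + (LINT t:{..x}|lborel. r t) = q x"
    using eventually_at_leftI[of c 0 "\<lambda>x. c < x \<and> x < 0", simplified, OF \<open>c < 0\<close>]
  proof eventually_elim
    case (elim x)
    then show ?case
      using q[of x] set_integral_atMost_diff[OF r, of c x] by (simp add: algebra_simps)
  qed
qed

text \<open>\<open>Lim\<close> has its intended value only where a limit exists; existence is the
  point here.\<close>

lemma W21_tendsto:
  assumes W: "W21_Omega \<psi> \<phi>"
  shows "(\<psi> \<longlongrightarrow> lim_plus0 \<psi>) (at_right 0)" "(\<psi> \<longlongrightarrow> lim_minus0 \<psi>) (at_left 0)"
proof -
  \<comment> \<open>\<open>\<phi>\<close> is only square integrable; truncation makes it integrable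
    and leaves it unchanged near 0.\<close>
  define r where "r = (\<lambda>t. indicator {-1..1} t *\<^sub>R \<phi> t)"
  have r: "integrable lborel r"
    using L2_set_integrable[OF W21_L2(2)[OF W]] by (simp add: r_def set_integrable_def)
  have rs: "(LINT t:{a..b}|lborel. r t) = (LINT t:{a..b}|lborel. \<phi> t)" if "-1 \<le> a" "b \<le> 1" for a b
    unfolding set_lebesgue_integral_def r_def using that
    by (intro Bochner_Integration.integral_cong) (auto simp: indicator_def)
  have "\<exists>l. (\<psi> \<longlongrightarrow> l) (at_right 0)"
    by (rule exI, rule tendsto_from_right[OF r, of 1]) (use W in \<open>auto simp: W21_Omega_iff rs\<close>)
  then show "(\<psi> \<longlongrightarrow> lim_plus0 \<psi>) (at_right 0)"
    unfolding lim_plus0_def by (metis tendsto_Lim trivial_limit_at_right_real)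
  have "\<exists>l. (\<psi> \<longlongrightarrow> l) (at_left 0)"
    by (rule exI, rule tendsto_from_left[OF r, of "-1"]) (use W in \<open>auto simp: W21_Omega_iff rs\<close>)
  then show "(\<psi> \<longlongrightarrow> lim_minus0 \<psi>) (at_left 0)"
    unfolding lim_minus0_def by (metis tendsto_Lim trivial_limit_at_left_real)
qed

lemma lim0_eqI:
  shows "(\<psi> \<longlongrightarrow> p) (at_right 0) \<Longrightarrow> lim_plus0 \<psi> = p"
    and "(\<psi> \<longlongrightarrow> m) (at_left 0) \<Longrightarrow> lim_minus0 \<psi> = m"
  by (simp_all add: lim_plus0_def lim_minus0_def tendsto_Lim)

text \<open>The indefinite integral of \<open>r\<close> differs from \<open>q\<close> by a constant on each half-line;
  as \<open>q\<close> is integrable, its limits at both infinities vanish, which determines the constants.\<close>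

lemma integral_jump_at_0:
  fixes q r :: "real \<Rightarrow> complex"
  assumes q: "integrable lborel q" and r: "integrable lborel r"
    and qr: "\<And>a b. a \<le> b \<Longrightarrow> 0 < a \<or> b < 0 \<Longrightarrow> (LINT t:{a..b}|lborel. r t) = q b - q a"
    and p: "(q \<longlongrightarrow> p) (at_right 0)" and m: "(q \<longlongrightarrow> m) (at_left 0)"
  shows "(LINT t|lborel. r t) = m - p"
proof -
  define P where "P = (\<lambda>x. LINT t:{..x}|lborel. r t)"
  have PP: "P b - P a = (LINT t:{a..b}|lborel. r t)" if "a \<le> b" for a b
    unfolding P_def by (rule set_integral_atMost_diff[OF r that])
  have "(q \<longlongrightarrow> q 1 - P 1 + P 0) (at_right 0)"
    unfolding P_def by (rule tendsto_from_right[OF r]) (auto simp: qr)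
  then have p': "p = q 1 - P 1 + P 0"
    using p tendsto_unique[OF trivial_limit_at_right_real] by blast
  have "(q \<longlongrightarrow> q (-1) - P (-1) + P 0) (at_left 0)"
    unfolding P_def by (rule tendsto_from_left[OF r]) (auto simp: qr)
  then have m': "m = q (-1) - P (-1) + P 0"
    using m tendsto_unique[OF trivial_limit_at_left_real] by blast
  have "(q \<longlongrightarrow> q 1 - P 1 + (LINT t|lborel. r t)) at_top"
  proof (rule Lim_transform_eventually)
    show "((\<lambda>x. q 1 - P 1 + P x) \<longlongrightarrow> q 1 - P 1 + (LINT t|lborel. r t)) at_top"
      unfolding P_def by (intro tendsto_intros tendsto_set_integral_atMost(1)[OF r])
    show "\<forall>\<^sub>F x in at_top. q 1 - P 1 + P x = q x"
      using eventually_ge_at_top[of 1]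
    proof eventually_elim
      case (elim x) then show ?case using PP[of 1 x] qr[of 1 x] by (simp add: algebra_simps)
    qed
  qed
  then have 1: "q 1 - P 1 + (LINT t|lborel. r t) = 0"
    by (rule integrable_tendsto_at_top_zero[OF q])
  have "(q \<longlongrightarrow> q (-1) - P (-1) + 0) at_bot"
  proof (rule Lim_transform_eventually)
    show "((\<lambda>x. q (-1) - P (-1) + P x) \<longlongrightarrow> q (-1) - P (-1) + 0) at_bot"
      unfolding P_def by (intro tendsto_intros tendsto_set_integral_atMost(2)[OF r])
    show "\<forall>\<^sub>F x in at_bot. q (-1) - P (-1) + P x = q x"
      using eventually_le_at_bot[of "-1"]
    proof eventually_elim
      case (elim x) then show ?case using PP[of x "-1"] qr[of x "-1"] by (simp add: algebra_simps)
    qed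
  qed
  \<comment> \<open>Reflection turns the limit at minus infinity into one at plus infinity, where an
    integrable function can only tend to 0.\<close>
  then have "((\<lambda>x. q (- x)) \<longlongrightarrow> q (-1) - P (-1)) at_top"
    by (simp add: filterlim_at_bot_mirror)
  moreover have "integrable lborel (\<lambda>x. q (- x))"
    using lborel_integrable_real_affine[OF q, of "-1" 0] by simp
  ultimately have 2: "q (-1) - P (-1) = 0"
    by (metis integrable_tendsto_at_top_zero)
  from 1 have "q 1 - P 1 = - (LINT t|lborel. r t)"
    by (simp add: eq_neg_iff_add_eq_0)
  with p' m' 2 show ?thesis by simp
qed

lemma set_integral_cnj:
  fixes f :: "real \<Rightarrow> complex"
  shows "(LINT t:A|M. cnj (f t)) = cnj (LINT t:A|M. f t)"
  unfolding set_lebesgue_integral_def by (simp only: complex_cnj_scaleR flip: Bochner_Integration.integral_cnj)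

text \<open>The product of \<open>\<psi>1\<close> with the conjugate of \<open>\<psi>2\<close> is
  integrable and obeys the product rule off 0, so only its jump at 0 contributes to the integral of
  the derivative.\<close>

lemma W21_Green:
  assumes W1: "W21_Omega \<psi>1 \<phi>1" and W2: "W21_Omega \<psi>2 \<phi>2"
  shows "(LINT x|lborel. \<phi>1 x * cnj (\<psi>2 x)) + (LINT x|lborel. \<psi>1 x * cnj (\<phi>2 x)) =
    lim_minus0 \<psi>1 * cnj (lim_minus0 \<psi>2) - lim_plus0 \<psi>1 * cnj (lim_plus0 \<psi>2)"
proof -
  note L = W21_L2[OF W1] W21_L2[OF W2]
  have i: "integrable lborel (\<lambda>x. \<phi>1 x * cnj (\<psi>2 x))" "integrable lborel (\<lambda>x. \<psi>1 x * cnj (\<phi>2 x))"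
    "integrable lborel (\<lambda>x. \<psi>1 x * cnj (\<psi>2 x))"
    using L by (auto intro!: L2_mult_integrable L2_cnj)
  have "(LINT x|lborel. \<phi>1 x * cnj (\<psi>2 x) + \<psi>1 x * cnj (\<phi>2 x)) =
    lim_minus0 \<psi>1 * cnj (lim_minus0 \<psi>2) - lim_plus0 \<psi>1 * cnj (lim_plus0 \<psi>2)"
  proof (rule integral_jump_at_0)
    show "integrable lborel (\<lambda>x. \<psi>1 x * cnj (\<psi>2 x))"
      "integrable lborel (\<lambda>x. \<phi>1 x * cnj (\<psi>2 x) + \<psi>1 x * cnj (\<phi>2 x))"
      using i by auto
    show "(LINT x:{a..b}|lborel. \<phi>1 x * cnj (\<psi>2 x) + \<psi>1 x * cnj (\<phi>2 x)) =
      \<psi>1 b * cnj (\<psi>2 b) - \<psi>1 a * cnj (\<psi>2 a)" if "a \<le> b" "0 < a \<or> b < 0" for a b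
      using W1 W2 that
      by (intro product_rule_integral(2) L2_set_integrable L2_cnj L)
        (auto simp: W21_Omega_iff set_integral_cnj)
  qed (intro tendsto_intros W21_tendsto[OF W1] W21_tendsto[OF W2])+
  then show ?thesis using i by simp
qed

text \<open>Young's inequality: Cauchy-Schwarz after writing \<open>|K| |h|\<close> as
  \<open>sqrt |K|\<close> times \<open>sqrt |K| |h|\<close>, then Tonelli.\<close>

lemma L2_convolution:
  assumes K: "integrable lborel K" and h: "L2 h"
  shows "L2 (\<lambda>x. LINT y|lborel. K (x - y) * h y)"
proof -
  have [measurable]: "K \<in> borel_measurable borel" "h \<in> borel_measurable borel"
    using K h by (auto dest: borel_measurable_integrable L2_measurable)
  define C where "C = (\<integral>\<^sup>+x. norm (K x) \<partial>lborel)"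
  define D where "D = (\<integral>\<^sup>+x. (norm (h x))\<^sup>2 \<partial>lborel)"
  have C: "C < \<infinity>" and D: "D < \<infinity>"
    using K h by (auto simp: C_def D_def integrable_iff_bounded L2_def)
  \<comment> \<open>Translation and reflection invariance make both marginals of the kernel equal to
    \<open>C\<close>: the first serves Cauchy-Schwarz, the second the exchanged integral.\<close>
  have C1: "(\<integral>\<^sup>+y. norm (K (x - y)) \<partial>lborel) = C" for x
    unfolding C_def using nn_integral_real_affine[of "\<lambda>t. ennreal (norm (K t))" "-1" x] by simp
  have C2: "(\<integral>\<^sup>+x. norm (K (x - y)) \<partial>lborel) = C" for y
    unfolding C_def using nn_integral_real_affine[of "\<lambda>t. ennreal (norm (K t))" "1" "-y"] by simp
  have bound: "ennreal ((norm (LINT y|lborel. K (x - y) * h y))\<^sup>2) \<le>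
      C * (\<integral>\<^sup>+y. norm (K (x - y)) * ennreal ((norm (h y))\<^sup>2) \<partial>lborel)" for x
  \<comment> \<open>For a non-integrable product the integral is 0 by convention and the bound is
    trivial.\<close>
  proof (cases "integrable lborel (\<lambda>y. K (x - y) * h y)")
    case True
    have "ennreal (norm (LINT y|lborel. K (x - y) * h y)) \<le> (\<integral>\<^sup>+y. norm (K (x - y) * h y) \<partial>lborel)"
      by (rule integral_norm_bound_ennreal[OF True])
    then have "ennreal ((norm (LINT y|lborel. K (x - y) * h y))\<^sup>2) \<le> (\<integral>\<^sup>+y. norm (K (x - y) * h y) \<partial>lborel)\<^sup>2"
      by (simp add: power_mono_ennreal flip: ennreal_power)
    also have "(\<integral>\<^sup>+y. norm (K (x - y) * h y) \<partial>lborel) =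
       (\<integral>\<^sup>+y. ennreal (sqrt (norm (K (x - y)))) * ennreal (sqrt (norm (K (x - y))) * norm (h y)) \<partial>lborel)"
      by (intro nn_integral_cong) (simp add: norm_mult flip: ennreal_mult mult.assoc)
    also have "\<dots>\<^sup>2 \<le> (\<integral>\<^sup>+y. ennreal (sqrt (norm (K (x - y)))) ^ 2 \<partial>lborel) *
       (\<integral>\<^sup>+y. ennreal (sqrt (norm (K (x - y))) * norm (h y)) ^ 2 \<partial>lborel)"
      by (rule Cauchy_Schwarz_nn_integral) measurable
    also have "(\<integral>\<^sup>+y. ennreal (sqrt (norm (K (x - y)))) ^ 2 \<partial>lborel) = C"
      unfolding C1[of x, symmetric] by (intro nn_integral_cong) (simp add: ennreal_power)
    also have "(\<integral>\<^sup>+y. ennreal (sqrt (norm (K (x - y))) * norm (h y)) ^ 2 \<partial>lborel) =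
        (\<integral>\<^sup>+y. norm (K (x - y)) * ennreal ((norm (h y))\<^sup>2) \<partial>lborel)"
      by (intro nn_integral_cong) (simp add: ennreal_power power_mult_distrib ennreal_mult)
    finally show ?thesis .
  qed (simp add: not_integrable_integral_eq)
  have meas: "(\<lambda>x. LINT y|lborel. K (x - y) * h y) \<in> borel_measurable borel" by measurable
  have "(\<integral>\<^sup>+x. ennreal ((norm (LINT y|lborel. K (x - y) * h y))\<^sup>2) \<partial>lborel)
      \<le> (\<integral>\<^sup>+x. C * (\<integral>\<^sup>+y. norm (K (x - y)) * ennreal ((norm (h y))\<^sup>2) \<partial>lborel) \<partial>lborel)"
    by (intro nn_integral_mono bound)
  also have "\<dots> = C * (\<integral>\<^sup>+x. (\<integral>\<^sup>+y. norm (K (x - y)) * ennreal ((norm (h y))\<^sup>2) \<partial>lborel) \<partial>lborel)"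
    by (rule nn_integral_cmult) measurable
  also have "(\<integral>\<^sup>+x. (\<integral>\<^sup>+y. norm (K (x - y)) * ennreal ((norm (h y))\<^sup>2) \<partial>lborel) \<partial>lborel) =
      (\<integral>\<^sup>+y. (\<integral>\<^sup>+x. norm (K (x - y)) * ennreal ((norm (h y))\<^sup>2) \<partial>lborel) \<partial>lborel)"
    by (rule lborel_pair.Fubini'[symmetric]) measurable
  also have "\<dots> = (\<integral>\<^sup>+y. C * ennreal ((norm (h y))\<^sup>2) \<partial>lborel)"
    by (intro nn_integral_cong) (simp add: nn_integral_multc C2)
  also have "\<dots> = C * D" unfolding D_def by (rule nn_integral_cmult) measurable
  finally have "(\<integral>\<^sup>+x. ennreal ((norm (LINT y|lborel. K (x - y) * h y))\<^sup>2) \<partial>lborel) \<le> C * (C * D)" .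
  also have "\<dots> < \<infinity>" using C D by (simp add: ennreal_mult_less_top)
  finally show ?thesis
    unfolding L2_def using meas by (auto simp: integrable_iff_bounded)
qed

section \<open>The Green function\<close>

lemma heaviside_measurable [measurable]: "heaviside \<in> borel_measurable borel"
  unfolding heaviside_def by measurable

lemma heaviside_mult_pos: "c > 0 \<Longrightarrow> heaviside (t * c) = heaviside t"
  by (simp add: heaviside_def zero_less_mult_iff)

text \<open>With \<open>c = Im z\<close> this is the modulus of \<open>g_fun z\<close>, with
  \<open>c = 2 * Im z\<close> its square. The substitution \<open>x\<close> to
  \<open>- c * x\<close> reduces both signs of \<open>c\<close> to \<open>exp (- x)\<close> on the
  positive half-line.\<close>

lemma integrable_heaviside_exp:
  assumes "c \<noteq> 0"
  shows "integrable lborel (\<lambda>x. heaviside (- x * c) * exp (x * c))"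
proof -
  have "set_integrable lebesgue {0..} (\<lambda>x::real. exp (- 1 * x))"
    by (rule nonnegative_absolutely_integrable_1[OF integrable_on_exp_minus_to_infinity]) auto
  then have "integrable lborel (\<lambda>x::real. indicator {0..} x *\<^sub>R exp (- x))"
    unfolding set_integrable_def by (subst (asm) integrable_completion) auto
  then have "integrable lborel (\<lambda>x. heaviside x * exp (- x))"
    by (rule Bochner_Integration.integrable_bound) (auto simp: heaviside_def)
  from lborel_integrable_real_affine[OF this, of "- c" 0] assms show ?thesis
    by (simp add: mult.commute)
qed

lemma g_fun_measurable [measurable]: "g_fun z \<in> borel_measurable borel"
proof -
  have "(\<lambda>x::real. exp (- \<i> * z * of_real x)) \<in> borel_measurable borel"
    by (intro borel_measurable_continuous_onI continuous_intros)
  then show ?thesis unfolding g_fun_def[abs_def] by measurable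
qed

lemma cmod_g_fun:
  assumes "Im z \<noteq> 0"
  shows "cmod (g_fun z x) = heaviside (- x * Im z) * exp (x * Im z)"
  using assms by (simp add: g_fun_def norm_mult abs_sgn_eq heaviside_def mult.commute)

lemma integrable_g_fun:
  assumes "Im z \<noteq> 0"
  shows "integrable lborel (g_fun z)"
proof (rule Bochner_Integration.integrable_bound[OF integrable_heaviside_exp[OF assms]])
  show "AE x in lborel. cmod (g_fun z x) \<le> norm (heaviside (- x * Im z) * exp (x * Im z))"
    by (simp only: cmod_g_fun[OF assms] real_norm_def abs_ge_self) simp
qed simp

lemma L2_g_fun:
  assumes "Im z \<noteq> 0"
  shows "L2 (g_fun z)"
proof -
  have "(cmod (g_fun z x))\<^sup>2 = heaviside (- x * (2 * Im z)) * exp (x * (2 * Im z))" for x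
    unfolding cmod_g_fun[OF assms]
    by (simp add: power_mult_distrib heaviside_def mult_less_0_iff exp_double[symmetric] ac_simps)
  then show ?thesis
    using integrable_heaviside_exp[of "2 * Im z"] assms by (simp add: L2_def)
qed

text \<open>For every \<open>x\<close>, not merely almost every one: the reflected translate of
  \<open>g_fun z\<close> is again in \<open>L2\<close>.\<close>

lemma g_fun_mult_integrable:
  assumes "Im z \<noteq> 0" "L2 h"
  shows "integrable lborel (\<lambda>y. g_fun z (x - y) * h y)"
proof (rule L2_mult_integrable[OF _ assms(2)])
  have "integrable lborel (\<lambda>y. (cmod (g_fun z (x + (-1) * y)))\<^sup>2)"
    by (rule lborel_integrable_real_affine[OF L2_square_integrable[OF L2_g_fun[OF assms(1)]]]) simp
  then show "L2 (\<lambda>y. g_fun z (x - y))" by (simp add: L2_def)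
qed

section \<open>Solutions of the resolvent equation and their boundary values\<close>

text \<open>The convolution solves \<open>\<i> u' - z u = h\<close>; \<open>g_fun z\<close> solves
  the homogeneous equation off 0, so \<open>c\<close> is a free parameter that adjusts the jump at
  0.\<close>

definition resolvent_fun :: "complex \<Rightarrow> complex \<Rightarrow> (real \<Rightarrow> complex) \<Rightarrow> real \<Rightarrow> complex" where
  "resolvent_fun z c h x = (LINT y|lborel. g_fun z (x - y) * h y) + c * g_fun z x"

lemma L2_resolvent_fun:
  assumes "Im z \<noteq> 0" "L2 h"
  shows "L2 (resolvent_fun z c h)"
  unfolding resolvent_fun_def[abs_def]
  by (intro L2_add L2_cmult L2_g_fun L2_convolution integrable_g_fun assms)

text \<open>What remains of \<open>g_fun z (x - y)\<close> once \<open>exp (- \<i> z x)\<close> is split off; it depends on \<open>x\<close> only through a jump at \<open>y = x\<close>.\<close>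

definition kern :: "complex \<Rightarrow> real \<Rightarrow> real \<Rightarrow> complex" where
  "kern z x y = \<i> * of_real (sgn (Im z)) * of_real (heaviside ((y - x) * Im z)) * exp (\<i> * z * of_real y)"

lemma g_fun_diff_eq_kern: "g_fun z (x - y) = exp (- \<i> * z * of_real x) * kern z x y"
proof -
  have "exp (- \<i> * z * of_real (x - y)) = exp (- \<i> * z * of_real x) * exp (\<i> * z * of_real y)"
    by (simp add: algebra_simps flip: exp_add)
  then show ?thesis by (simp add: g_fun_def kern_def)
qed

text \<open>It links the perturbation in \<open>green\<close> to the convolution: the integral of
  \<open>kern z 0 y * h y\<close> is the value at 0 of the convolution part.\<close>

lemma kern_0: "kern z 0 y = cnj (g_fun (cnj z) y)"
  by (simp add: g_fun_def kern_def sgn_minus exp_cnj)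

lemma kern_mult_integrable:
  assumes "Im z \<noteq> 0" "L2 h"
  shows "integrable lborel (\<lambda>y. kern z x y * h y)"
  using integrable_mult_right[OF g_fun_mult_integrable[OF assms, of x], of "exp (\<i> * z * of_real x)"]
  by (simp add: g_fun_diff_eq_kern exp_minus flip: mult.assoc)

text \<open>Moving \<open>x\<close> from \<open>a\<close> to \<open>b\<close> changes
  \<open>kern z x y\<close> only for \<open>y\<close> between them, where the change is
  \<open>- \<i> * exp (\<i> * z * y)\<close> for either sign of \<open>Im z\<close>; the endpoints
  form a null set.\<close>

lemma kern_integral_diff:
  assumes z: "Im z \<noteq> 0" and h: "L2 h" and ab: "a \<le> b"
  shows "set_integrable lborel {a..b} (\<lambda>y. - \<i> * exp (\<i> * z * of_real y) * h y)"
    and "(LINT y:{a..b}|lborel. - \<i> * exp (\<i> * z * of_real y) * h y) =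
      (LINT y|lborel. kern z b y * h y) - (LINT y|lborel. kern z a y * h y)"
proof -
  let ?r = "\<lambda>y. indicator {a..b} y *\<^sub>R (- \<i> * exp (\<i> * z * of_real y) * h y)"
  note K = kern_mult_integrable[OF z h]
  have "AE y in lborel. y \<noteq> a" "AE y in lborel. y \<noteq> b" by (rule AE_lborel_singleton)+
  then have ae: "AE y in lborel. ?r y = kern z b y * h y - kern z a y * h y"
  proof eventually_elim
    case (elim y)
    show ?case
    proof (cases "Im z > 0")
      case True
      then show ?thesis using elim ab
        by (auto simp: kern_def heaviside_def indicator_def zero_less_mult_iff)
    next
      case False
      then show ?thesis using elim ab z
        by (auto simp: kern_def heaviside_def indicator_def zero_less_mult_iff)
    qed
  qed
  have "(\<lambda>x::real. exp (\<i> * z * of_real x)) \<in> borel_measurable borel"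
    by (intro borel_measurable_continuous_onI continuous_intros)
  then have m: "?r \<in> borel_measurable borel"
    using L2_measurable[OF h] by measurable
  have mK: "(\<lambda>y. kern z b y * h y - kern z a y * h y) \<in> borel_measurable lborel"
    using K by (intro borel_measurable_diff borel_measurable_integrable)
  show "set_integrable lborel {a..b} (\<lambda>y. - \<i> * exp (\<i> * z * of_real y) * h y)"
    unfolding set_integrable_def
    by (rule integrable_cong_AE[THEN iffD2, OF _ mK ae]) (use m K in simp_all)
  have "integral\<^sup>L lborel ?r = (LINT y|lborel. kern z b y * h y - kern z a y * h y)"
    by (rule integral_cong_AE[OF _ mK ae]) (use m in simp)
  then show "(LINT y:{a..b}|lborel. - \<i> * exp (\<i> * z * of_real y) * h y) =
      (LINT y|lborel. kern z b y * h y) - (LINT y|lborel. kern z a y * h y)"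
    using K by (simp add: set_lebesgue_integral_def)
qed

text \<open>The exponential is split off from a bracket that is an indefinite integral plus a term
  constant on each half-line, which is the form the product rule requires.\<close>

lemma resolvent_fun_eq_kern:
  "resolvent_fun z c h x = exp (- \<i> * z * of_real x) *
     ((LINT y|lborel. kern z x y * h y) + c * \<i> * of_real (sgn (Im z)) * of_real (heaviside (- x * Im z)))"
  by (simp add: resolvent_fun_def g_fun_diff_eq_kern g_fun_def[of z x] mult.assoc distrib_left)

text \<open>As an indefinite integral this part is continuous at 0, so any jump of
  \<open>resolvent_fun\<close> comes from the term with \<open>c\<close>.\<close>

lemma tendsto_kern_integral:
  assumes z: "Im z \<noteq> 0" and h: "L2 h"
  shows "((\<lambda>x. LINT y|lborel. kern z x y * h y) \<longlongrightarrow> (LINT y|lborel. kern z 0 y * h y)) (at_right 0)"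
    and "((\<lambda>x. LINT y|lborel. kern z x y * h y) \<longlongrightarrow> (LINT y|lborel. kern z 0 y * h y)) (at_left 0)"
proof -
  define F where "F = (\<lambda>x. LINT y|lborel. kern z x y * h y)"
  define r where "r = (\<lambda>y. indicator {-1..1} y *\<^sub>R (- \<i> * exp (\<i> * z * of_real y) * h y))"
  have r: "integrable lborel r"
    using kern_integral_diff(1)[OF z h, of "-1" 1] by (simp add: r_def set_integrable_def)
  have F: "F b - F a = (LINT y:{a..b}|lborel. r y)" if "-1 \<le> a" "a \<le> b" "b \<le> 1" for a b
  proof -
    have "(LINT y:{a..b}|lborel. r y) = (LINT y:{a..b}|lborel. - \<i> * exp (\<i> * z * of_real y) * h y)"
      unfolding set_lebesgue_integral_def r_def using that
      by (intro Bochner_Integration.integral_cong) (auto simp: indicator_def)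
    then show ?thesis using kern_integral_diff(2)[OF z h \<open>a \<le> b\<close>] by (simp add: F_def)
  qed
  have "(F \<longlongrightarrow> F 1 - (LINT t:{..1}|lborel. r t) + (LINT t:{..0}|lborel. r t)) (at_right 0)"
    by (rule tendsto_from_right[OF r]) (auto simp: F)
  moreover have "F 1 - (LINT t:{..1}|lborel. r t) + (LINT t:{..0}|lborel. r t) = F 0"
    using set_integral_atMost_diff[OF r, of 0 1] F[of 0 1] by (simp add: algebra_simps)
  ultimately show "((\<lambda>x. LINT y|lborel. kern z x y * h y) \<longlongrightarrow> (LINT y|lborel. kern z 0 y * h y)) (at_right 0)"
    by (simp add: F_def)
  have "(F \<longlongrightarrow> F (-1) - (LINT t:{..-1}|lborel. r t) + (LINT t:{..0}|lborel. r t)) (at_left 0)"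
    by (rule tendsto_from_left[OF r]) (auto simp: F)
  moreover have "F (-1) - (LINT t:{..-1}|lborel. r t) + (LINT t:{..0}|lborel. r t) = F 0"
    using set_integral_atMost_diff[OF r, of "-1" 0] F[of "-1" 0] by (simp add: algebra_simps)
  ultimately show "((\<lambda>x. LINT y|lborel. kern z x y * h y) \<longlongrightarrow> (LINT y|lborel. kern z 0 y * h y)) (at_left 0)"
    by (simp add: F_def)
qed

text \<open>The step \<open>heaviside (- x * Im z)\<close> depends only on the sign of
  \<open>x\<close>, and it is nonzero on just one side; so \<open>c\<close> enters only one of the
  two limits.\<close>

lemma resolvent_fun_lim0:
  assumes z: "Im z \<noteq> 0" and h: "L2 h"
  shows "lim_plus0 (resolvent_fun z c h) = (LINT y|lborel. kern z 0 y * h y)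
           + c * \<i> * of_real (sgn (Im z)) * of_real (heaviside (- Im z))"
    and "lim_minus0 (resolvent_fun z c h) = (LINT y|lborel. kern z 0 y * h y)
           + c * \<i> * of_real (sgn (Im z)) * of_real (heaviside (Im z))"
proof -
  define F where "F = (\<lambda>x. LINT y|lborel. kern z x y * h y)"
  define s where "s = (\<lambda>t. c * \<i> * of_real (sgn (Im z)) * of_real (heaviside t))"
  have e: "((\<lambda>x::real. exp (- \<i> * z * of_real x)) \<longlongrightarrow> 1) (at 0 within S)" for S
    by (auto intro!: tendsto_eq_intros)
  have "((\<lambda>x. exp (- \<i> * z * of_real x) * (F x + s (- Im z))) \<longlongrightarrow> 1 * (F 0 + s (- Im z))) (at_right 0)"
    unfolding F_def by (intro tendsto_intros e tendsto_kern_integral z h)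
  moreover have "\<forall>\<^sub>F x in at_right 0. exp (- \<i> * z * of_real x) * (F x + s (- Im z)) = resolvent_fun z c h x"
    using eventually_at_right_less[of 0]
  proof eventually_elim
    case (elim x)
    then show ?case
      using heaviside_mult_pos[of x "- Im z"] by (simp add: resolvent_fun_eq_kern F_def s_def mult.commute)
  qed
  ultimately show "lim_plus0 (resolvent_fun z c h) = (LINT y|lborel. kern z 0 y * h y)
           + c * \<i> * of_real (sgn (Im z)) * of_real (heaviside (- Im z))"
    by (intro lim0_eqI) (auto simp: F_def s_def dest: Lim_transform_eventually)
  have "((\<lambda>x. exp (- \<i> * z * of_real x) * (F x + s (Im z))) \<longlongrightarrow> 1 * (F 0 + s (Im z))) (at_left 0)"
    unfolding F_def by (intro tendsto_intros e tendsto_kern_integral z h)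
  moreover have "\<forall>\<^sub>F x in at_left (0::real). x < 0"
    by (rule eventually_at_leftI[of "-1"]) auto
  then have "\<forall>\<^sub>F x in at_left 0. exp (- \<i> * z * of_real x) * (F x + s (Im z)) = resolvent_fun z c h x"
  proof eventually_elim
    case (elim x)
    then show ?case
      using heaviside_mult_pos[of "- x" "Im z"] by (simp add: resolvent_fun_eq_kern F_def s_def mult.commute)
  qed
  ultimately show "lim_minus0 (resolvent_fun z c h) = (LINT y|lborel. kern z 0 y * h y)
           + c * \<i> * of_real (sgn (Im z)) * of_real (heaviside (Im z))"
    by (intro lim0_eqI) (auto simp: F_def s_def dest: Lim_transform_eventually)
qed

text \<open>The derivative is that dictated by \<open>\<i> u' = z u + h\<close>. It is obtained from
  the product rule for \<open>exp (- \<i> * z * x)\<close> times the bracket of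
  \<open>resolvent_fun_eq_kern\<close>.\<close>

lemma W21_resolvent_fun:
  assumes z: "Im z \<noteq> 0" and h: "L2 h"
  shows "W21_Omega (resolvent_fun z c h) (\<lambda>x. - \<i> * (z * resolvent_fun z c h x + h x))"
  unfolding W21_Omega_iff
proof (intro conjI allI impI)
  show R: "L2 (resolvent_fun z c h)" by (rule L2_resolvent_fun[OF z h])
  show "L2 (\<lambda>x. - \<i> * (z * resolvent_fun z c h x + h x))"
    by (intro L2_cmult L2_add R h)
  fix a b :: real assume ab: "a \<le> b" "0 < a \<or> b < 0"
  define s where "s = (\<lambda>x. c * \<i> * of_real (sgn (Im z)) * of_real (heaviside (- x * Im z)))"
  define g where "g = (\<lambda>x. (LINT y|lborel. kern z x y * h y) + s a)"
  \<comment> \<open>The interval avoids 0, so the jump term is constant on it and can be included in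
    \<open>g\<close>.\<close>
  have s: "s x = s a" if "a \<le> x" "x \<le> b" for x
    using ab that by (auto simp: s_def heaviside_def mult_less_0_iff)
  have R_eq: "resolvent_fun z c h x = exp (- \<i> * z * of_real x) * g x" if "a \<le> x" "x \<le> b" for x
    using s[OF that] by (simp add: resolvent_fun_eq_kern g_def s_def)
  have cont: "continuous_on S (\<lambda>x. - \<i> * z * exp (- \<i> * z * of_real x))" for S
    by (intro continuous_intros)
  have FTC: "(LINT t:{a..x}|lborel. - \<i> * z * exp (- \<i> * z * of_real t)) =
      exp (- \<i> * z * of_real x) - exp (- \<i> * z * of_real a)" if "a \<le> x" for x
    unfolding set_lebesgue_integral_def
  proof (rule integral_FTC_atLeastAtMost[OF that _ cont])
    fix t
    show "((\<lambda>x. exp (- \<i> * z * of_real x)) has_vector_derivative - \<i> * z * exp (- \<i> * z * of_real t)) (at t within {a..x})"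
      by (auto intro!: derivative_eq_intros has_vector_derivative_real_field)
  qed
  have "(LINT x:{a..b}|lborel. - \<i> * z * exp (- \<i> * z * of_real x) * g x +
      exp (- \<i> * z * of_real x) * (- \<i> * exp (\<i> * z * of_real x) * h x))
    = exp (- \<i> * z * of_real b) * g b - exp (- \<i> * z * of_real a) * g a"
  proof (rule product_rule_integral(2)[OF ab(1)])
    show "set_integrable lborel {a..b} (\<lambda>x. - \<i> * z * exp (- \<i> * z * of_real x))"
      by (rule borel_integrable_atLeastAtMost'[OF cont])
    show "set_integrable lborel {a..b} (\<lambda>x. - \<i> * exp (\<i> * z * of_real x) * h x)"
      by (rule kern_integral_diff(1)[OF z h ab(1)])
    show "(LINT t:{a..x}|lborel. - \<i> * exp (\<i> * z * of_real t) * h t) = g x - g a" if "a \<le> x" for x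
      using kern_integral_diff(2)[OF z h that] by (simp add: g_def)
  qed (rule FTC)
  also have "\<dots> = resolvent_fun z c h b - resolvent_fun z c h a"
    using R_eq[of a] R_eq[of b] ab by simp
  also have "(LINT x:{a..b}|lborel. - \<i> * z * exp (- \<i> * z * of_real x) * g x +
      exp (- \<i> * z * of_real x) * (- \<i> * exp (\<i> * z * of_real x) * h x)) =
      (LINT x:{a..b}|lborel. - \<i> * (z * resolvent_fun z c h x + h x))"
  proof (rule set_lebesgue_integral_cong)
    show "\<forall>x. x \<in> {a..b} \<longrightarrow> - \<i> * z * exp (- \<i> * z * of_real x) * g x +
      exp (- \<i> * z * of_real x) * (- \<i> * exp (\<i> * z * of_real x) * h x) =
      - \<i> * (z * resolvent_fun z c h x + h x)"
      by (auto simp: R_eq exp_minus algebra_simps)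
  qed simp
  finally show "(LINT x:{a..b}|lborel. - \<i> * (z * resolvent_fun z c h x + h x)) =
     resolvent_fun z c h b - resolvent_fun z c h a" .
qed

lemma green_integral:
  assumes z: "Im z \<noteq> 0" and h: "L2 h"
  shows "integrable lborel (\<lambda>y. green z \<alpha> x y * h y)"
    and "(LINT y|lborel. green z \<alpha> x y * h y) =
      resolvent_fun z (beta_fun z \<alpha> * (LINT y|lborel. kern z 0 y * h y)) h x"
proof -
  have eq: "green z \<alpha> x y * h y = g_fun z (x - y) * h y + g_fun z x * beta_fun z \<alpha> * (kern z 0 y * h y)" for y
    by (simp add: green_def kern_0 algebra_simps)
  note i = g_fun_mult_integrable[OF z h, of x] kern_mult_integrable[OF z h, of 0]
  show "integrable lborel (\<lambda>y. green z \<alpha> x y * h y)"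
    unfolding eq using i by auto
  show "(LINT y|lborel. green z \<alpha> x y * h y) =
      resolvent_fun z (beta_fun z \<alpha> * (LINT y|lborel. kern z 0 y * h y)) h x"
    unfolding eq using i by (simp add: resolvent_fun_def)
qed

section \<open>Self-adjointness\<close>

lemma l2_inner_diff_left:
  "L2 f \<Longrightarrow> L2 g \<Longrightarrow> L2 k \<Longrightarrow> l2_inner (\<lambda>x. f x - g x) k = l2_inner f k - l2_inner g k"
  unfolding l2_inner_def left_diff_distrib
  by (intro Bochner_Integration.integral_diff L2_mult_integrable L2_cnj)

lemma l2_inner_add_left:
  "L2 f \<Longrightarrow> L2 g \<Longrightarrow> L2 k \<Longrightarrow> l2_inner (\<lambda>x. f x + g x) k = l2_inner f k + l2_inner g k"
  unfolding l2_inner_def distrib_right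
  by (intro Bochner_Integration.integral_add L2_mult_integrable L2_cnj)

lemma l2_inner_cmult_left: "l2_inner (\<lambda>x. c * f x) k = c * l2_inner f k"
  by (simp add: l2_inner_def mult.assoc)

lemma cnj_l2_inner: "cnj (l2_inner f g) = l2_inner g f"
  unfolding l2_inner_def by (simp add: mult.commute flip: Bochner_Integration.integral_cnj)

lemma l2_inner_diff_right:
  "L2 f \<Longrightarrow> L2 g \<Longrightarrow> L2 k \<Longrightarrow> l2_inner k (\<lambda>x. f x - g x) = l2_inner k f - l2_inner k g"
  by (metis cnj_l2_inner complex_cnj_diff l2_inner_diff_left)

lemma l2_inner_add_right:
  "L2 f \<Longrightarrow> L2 g \<Longrightarrow> L2 k \<Longrightarrow> l2_inner k (\<lambda>x. f x + g x) = l2_inner k f + l2_inner k g"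
  by (metis cnj_l2_inner complex_cnj_add l2_inner_add_left)

lemma l2_inner_cmult_right: "l2_inner k (\<lambda>x. c * f x) = cnj c * l2_inner k f"
  by (metis cnj_l2_inner complex_cnj_mult l2_inner_cmult_left)

lemma l2_inner_cong_AE:
  assumes "L2 f" "L2 f'" "L2 g" "L2 g'" "ae_eq f f'" "ae_eq g g'"
  shows "l2_inner f g = l2_inner f' g'"
  unfolding l2_inner_def
proof (rule integral_cong_AE)
  show "AE x in lborel. f x * cnj (g x) = f' x * cnj (g' x)"
    using assms(5,6) unfolding ae_eq_def by eventually_elim simp
qed (intro borel_measurable_integrable L2_mult_integrable L2_cnj assms)+

lemma l2_inner_self_eq_0:
  assumes "L2 f" "l2_inner f f = 0"
  shows "AE x in lborel. f x = 0"
proof -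
  have "l2_inner f f = of_real (LINT x|lborel. (cmod (f x))\<^sup>2)"
    unfolding l2_inner_def complex_norm_square[symmetric] by (rule integral_complex_of_real)
  then have "(LINT x|lborel. (cmod (f x))\<^sup>2) = 0" using assms(2) by simp
  then show ?thesis
    using integral_nonneg_eq_0_iff_AE[OF L2_square_integrable[OF assms(1)]] by simp
qed

lemma D_graphE:
  assumes "(f, g) \<in> D_graph S"
  obtains \<psi> \<phi> where "W21_Omega \<psi> \<phi>" "S \<psi>" "ae_eq f \<psi>" "ae_eq g (\<lambda>x. \<i> * \<phi> x)" "L2 f" "L2 g"
  using assms by (auto simp: D_graph_def)

lemma D_graph_L2: "(f, g) \<in> D_graph S \<Longrightarrow> L2 f \<and> L2 g"
  by (simp add: D_graph_def)

lemma D_graph_mono: "(\<And>\<psi>. S \<psi> \<Longrightarrow> T \<psi>) \<Longrightarrow> D_graph S \<subseteq> D_graph T"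
  unfolding D_graph_def by blast

text \<open>Graphs consist of functions rather than of classes; this allows either component to be
  changed on a null set.\<close>

lemma D_graph_cong:
  assumes "(f, g) \<in> D_graph S" "L2 u" "L2 v" "ae_eq u f" "ae_eq v g"
  shows "(u, v) \<in> D_graph S"
proof -
  have "ae_eq a c" if "ae_eq a b" "ae_eq b c" for a b c
    using that unfolding ae_eq_def by eventually_elim simp
  then show ?thesis using assms unfolding D_graph_def by blast
qed

text \<open>Since \<open>cnj \<i> = - \<i>\<close>, the difference of inner products is
  \<open>\<i>\<close> times the sum in \<open>W21_Green\<close>.\<close>

lemma D_graph_Green:
  assumes W1: "W21_Omega \<psi>1 \<phi>1" "ae_eq f1 \<psi>1" "ae_eq g1 (\<lambda>x. \<i> * \<phi>1 x)" "L2 f1" "L2 g1"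
    and W2: "W21_Omega \<psi>2 \<phi>2" "ae_eq f2 \<psi>2" "ae_eq g2 (\<lambda>x. \<i> * \<phi>2 x)" "L2 f2" "L2 g2"
  shows "l2_inner g1 f2 - l2_inner f1 g2 =
    \<i> * (lim_minus0 \<psi>1 * cnj (lim_minus0 \<psi>2) - lim_plus0 \<psi>1 * cnj (lim_plus0 \<psi>2))"
proof -
  note L = W21_L2[OF W1(1)] W21_L2[OF W2(1)]
  have "l2_inner g1 f2 = l2_inner (\<lambda>x. \<i> * \<phi>1 x) \<psi>2"
    by (intro l2_inner_cong_AE L2_cmult W1 W2 L)
  also have "\<dots> = \<i> * l2_inner \<phi>1 \<psi>2" by (rule l2_inner_cmult_left)
  finally have 1: "l2_inner g1 f2 = \<i> * l2_inner \<phi>1 \<psi>2" .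
  have "l2_inner f1 g2 = l2_inner \<psi>1 (\<lambda>x. \<i> * \<phi>2 x)"
    by (intro l2_inner_cong_AE L2_cmult W1 W2 L)
  also have "\<dots> = - \<i> * l2_inner \<psi>1 \<phi>2" by (simp add: l2_inner_cmult_right)
  finally have 2: "l2_inner f1 g2 = - \<i> * l2_inner \<psi>1 \<phi>2" .
  show ?thesis
    unfolding 1 2 W21_Green[OF W1(1) W2(1), symmetric] by (simp add: l2_inner_def algebra_simps)
qed

lemma D_alpha_symmetric:
  assumes 1: "(f1, g1) \<in> D_alpha \<alpha>" and 2: "(f2, g2) \<in> D_alpha \<alpha>"
  shows "l2_inner g1 f2 = l2_inner f1 g2"
proof -
  obtain \<psi>1 \<phi>1 where W1: "W21_Omega \<psi>1 \<phi>1" "ae_eq f1 \<psi>1" "ae_eq g1 (\<lambda>x. \<i> * \<phi>1 x)" "L2 f1" "L2 g1"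
    and S1: "lim_plus0 \<psi>1 = exp (\<i> * of_real \<alpha>) * lim_minus0 \<psi>1"
    using 1 unfolding D_alpha_def by (elim D_graphE)
  obtain \<psi>2 \<phi>2 where W2: "W21_Omega \<psi>2 \<phi>2" "ae_eq f2 \<psi>2" "ae_eq g2 (\<lambda>x. \<i> * \<phi>2 x)" "L2 f2" "L2 g2"
    and S2: "lim_plus0 \<psi>2 = exp (\<i> * of_real \<alpha>) * lim_minus0 \<psi>2"
    using 2 unfolding D_alpha_def by (elim D_graphE)
  \<comment> \<open>The phase is unimodular, so the contributions at +0 and -0 to the boundary form
    cancel.\<close>
  have "exp (\<i> * of_real \<alpha>) * cnj (exp (\<i> * of_real \<alpha>)) = 1"
    by (simp add: exp_cnj flip: exp_add)
  then have "lim_plus0 \<psi>1 * cnj (lim_plus0 \<psi>2) = lim_minus0 \<psi>1 * cnj (lim_minus0 \<psi>2)"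
    unfolding S1 S2 complex_cnj_mult by (metis mult.assoc mult.commute mult_1)
  with D_graph_Green[OF W1 W2] show ?thesis by simp
qed

lemma D_min_subset_D_alpha: "D_min \<subseteq> D_alpha \<alpha>"
  unfolding D_min_def D_alpha_def by (rule D_graph_mono) simp

lemma D_alpha_subset_D_max: "D_alpha \<alpha> \<subseteq> D_max"
  unfolding D_max_def D_alpha_def by (rule D_graph_mono) simp

text \<open>In terms of graphs, \<open>(D - z) u = h\<close> reads: the pair of \<open>u\<close> and
  \<open>h + z u\<close> belongs to \<open>D\<close>.\<close>

lemma resolvent_fun_mem_D_graph:
  assumes z: "Im z \<noteq> 0" and h: "L2 h" and S: "S (resolvent_fun z c h)"
  shows "(resolvent_fun z c h, \<lambda>x. h x + z * resolvent_fun z c h x) \<in> D_graph S"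
  unfolding D_graph_def mem_Collect_eq prod.case
proof (intro conjI exI)
  show "W21_Omega (resolvent_fun z c h) (\<lambda>x. - \<i> * (z * resolvent_fun z c h x + h x))"
    by (rule W21_resolvent_fun[OF z h])
qed (use S in \<open>auto simp: ae_eq_def algebra_simps intro!: L2_add L2_cmult L2_resolvent_fun z h\<close>)

abbreviation resolvent_alpha :: "complex \<Rightarrow> real \<Rightarrow> (real \<Rightarrow> complex) \<Rightarrow> real \<Rightarrow> complex" where
  "resolvent_alpha z \<alpha> h \<equiv> resolvent_fun z (beta_fun z \<alpha> * (LINT y|lborel. kern z 0 y * h y)) h"

text \<open>Let \<open>I\<close> be the integral of \<open>kern z 0 y * h y\<close>. For
  \<open>Im z > 0\<close> the limits at +0 and -0 are \<open>I\<close> and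
  \<open>exp (- \<i> * \<alpha>) * I\<close>; for \<open>Im z < 0\<close> they are
  \<open>exp (\<i> * \<alpha>) * I\<close> and \<open>I\<close>. This is how \<open>beta_fun\<close>
  is determined.\<close>

lemma resolvent_alpha_mem:
  assumes z: "Im z \<noteq> 0" and h: "L2 h"
  shows "(resolvent_alpha z \<alpha> h, \<lambda>x. h x + z * resolvent_alpha z \<alpha> h x) \<in> D_alpha \<alpha>"
  unfolding D_alpha_def
proof (rule resolvent_fun_mem_D_graph[OF z h])
  define E where "E = exp (\<i> * complex_of_real \<alpha>)"
  have E: "E \<noteq> 0" "exp (- (\<i> * complex_of_real \<alpha>)) = inverse E"
    by (simp_all add: E_def exp_minus)
  show "lim_plus0 (resolvent_alpha z \<alpha> h) = exp (\<i> * of_real \<alpha>) * lim_minus0 (resolvent_alpha z \<alpha> h)"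
    unfolding resolvent_fun_lim0[OF z h] E_def[symmetric]
    using z E by (cases "Im z > 0")
      (auto simp: beta_fun_def heaviside_def E_def[symmetric] algebra_simps)
qed

text \<open>Testing with \<open>(D - cnj z)\<^sup>-\<^sup>1 k\<close>, where \<open>k\<close> is the difference of two solutions, gives
  \<open>\<langle>k, k\<rangle> = 0\<close> from symmetry alone.\<close>

lemma D_alpha_resolvent_unique:
  assumes z: "Im z \<noteq> 0" and h: "L2 h" and u: "(u, \<lambda>x. h x + z * u x) \<in> D_alpha \<alpha>"
  shows "ae_eq u (resolvent_alpha z \<alpha> h)"
proof -
  define w where "w = resolvent_alpha z \<alpha> h"
  define k where "k = (\<lambda>x. u x - w x)"
  define f where "f = resolvent_alpha (cnj z) \<alpha> k"
  have w: "(w, \<lambda>x. h x + z * w x) \<in> D_alpha \<alpha>"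
    unfolding w_def by (rule resolvent_alpha_mem[OF z h])
  have Lu: "L2 u" and Lw: "L2 w" using u w by (auto simp: D_alpha_def D_graph_def)
  then have Lk: "L2 k" unfolding k_def by (rule L2_diff)
  have f: "(f, \<lambda>x. k x + cnj z * f x) \<in> D_alpha \<alpha>"
    unfolding f_def by (rule resolvent_alpha_mem) (use z Lk in auto)
  then have Lf: "L2 f" by (auto simp: D_alpha_def D_graph_def)
  \<comment> \<open>Symmetry tested against \<open>f\<close> makes the terms with \<open>z\<close>
    cancel, so every solution \<open>a\<close> has the same inner product with
    \<open>k\<close>.\<close>
  have *: "l2_inner a k = l2_inner h f" if "(a, \<lambda>x. h x + z * a x) \<in> D_alpha \<alpha>" "L2 a" for a
    using D_alpha_symmetric[OF that(1) f] that(2) h Lk Lf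
    by (simp add: l2_inner_add_left l2_inner_add_right l2_inner_cmult_left l2_inner_cmult_right L2_cmult)
  have "l2_inner k k = 0"
    using *[OF u Lu] *[OF w Lw] l2_inner_diff_left[OF Lu Lw Lk] by (simp add: k_def)
  then have "AE x in lborel. k x = 0" by (rule l2_inner_self_eq_0[OF Lk])
  then show ?thesis unfolding ae_eq_def w_def[symmetric] k_def by simp
qed

section \<open>Adjoints of \<open>D_alpha\<close> and \<open>D_min\<close>\<close>

lemma adjoint_graph_antimono: "A \<subseteq> B \<Longrightarrow> adjoint_graph B \<subseteq> adjoint_graph A"
  unfolding adjoint_graph_def by blast

lemma adjoint_graphI:
  "L2 u \<Longrightarrow> L2 v \<Longrightarrow> (\<And>f g. (f, g) \<in> A \<Longrightarrow> l2_inner g u = l2_inner f v) \<Longrightarrow> (u, v) \<in> adjoint_graph A"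
  by (auto simp: adjoint_graph_def)

lemma adjoint_graphD:
  assumes "(u, v) \<in> adjoint_graph A"
  shows "L2 u" "L2 v" "(f, g) \<in> A \<Longrightarrow> l2_inner g u = l2_inner f v"
  using assms by (auto simp: adjoint_graph_def)

text \<open>The common core of both adjoint computations. Here
  \<open>(D_alpha - \<i>) w = v - \<i> u\<close> and \<open>k = (A + \<i>) f\<close>, so
  \<open>k\<close> has inner product \<open>l2_inner f (v - \<i> u)\<close> with \<open>u\<close> by
  adjointness and with \<open>w\<close> by symmetry.\<close>

lemma adjoint_defect:
  assumes A: "A \<subseteq> D_alpha \<alpha>" and uv: "(u, v) \<in> adjoint_graph A" and w: "(w, \<lambda>x. v x - \<i> * u x + \<i> * w x) \<in> D_alpha \<alpha>"
    and f: "(f, \<lambda>x. k x - \<i> * f x) \<in> A" and k: "L2 k"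
  shows "l2_inner k (\<lambda>x. u x - w x) = 0"
proof -
  note L = adjoint_graphD(1,2)[OF uv]
  have Lw: "L2 w" using w by (auto simp: D_alpha_def D_graph_def)
  have Lf: "L2 f" using f A by (auto simp: D_alpha_def D_graph_def)
  note simps = l2_inner_add_left l2_inner_add_right l2_inner_cmult_left l2_inner_cmult_right L2_cmult
    l2_inner_diff_left l2_inner_diff_right L2_diff L2_add L Lw Lf k
  have 1: "l2_inner k u - \<i> * l2_inner f u = l2_inner f v"
    using adjoint_graphD(3)[OF uv f] by (simp add: simps)
  have "l2_inner k w - \<i> * l2_inner f w = l2_inner f v + \<i> * l2_inner f u - \<i> * l2_inner f w"
    using D_alpha_symmetric[OF subsetD[OF A f] w] by (simp add: simps)
  with 1 have "l2_inner k u = l2_inner k w" by (simp add: algebra_simps)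
  then show ?thesis by (simp add: simps)
qed

lemma adjoint_D_alpha: "adjoint_graph (D_alpha \<alpha>) = D_alpha \<alpha>"
proof (intro equalityI subrelI)
  fix u v assume uv: "(u, v) \<in> D_alpha \<alpha>"
  then show "(u, v) \<in> adjoint_graph (D_alpha \<alpha>)"
    using D_alpha_symmetric[OF _ uv] D_graph_L2[OF uv[unfolded D_alpha_def]] by (intro adjoint_graphI) auto
next
  fix u v assume uv: "(u, v) \<in> adjoint_graph (D_alpha \<alpha>)"
  note L = adjoint_graphD(1,2)[OF uv]
  define w where "w = resolvent_alpha \<i> \<alpha> (\<lambda>x. v x - \<i> * u x)"
  define k where "k = (\<lambda>x. u x - w x)"
  define f where "f = resolvent_alpha (- \<i>) \<alpha> k"
  have w: "(w, \<lambda>x. v x - \<i> * u x + \<i> * w x) \<in> D_alpha \<alpha>"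
    unfolding w_def by (intro resolvent_alpha_mem L2_diff L2_cmult L) simp
  then have Lw: "L2 w" by (auto simp: D_alpha_def D_graph_def)
  have Lk: "L2 k" unfolding k_def by (intro L2_diff L Lw)
  have f: "(f, \<lambda>x. k x - \<i> * f x) \<in> D_alpha \<alpha>"
    using resolvent_alpha_mem[of "-\<i>" k \<alpha>] Lk by (simp add: f_def)
  \<comment> \<open>The range of \<open>D_alpha + \<i>\<close> contains \<open>k = u - w\<close>
    itself, so \<open>k\<close> is orthogonal to itself.\<close>
  from adjoint_defect[OF subset_refl uv w this Lk] have "l2_inner k k = 0" by (simp add: k_def)
  then have k0: "AE x in lborel. k x = 0" by (rule l2_inner_self_eq_0[OF Lk])
  show "(u, v) \<in> D_alpha \<alpha>"
    unfolding D_alpha_def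
  proof (rule D_graph_cong[OF w[unfolded D_alpha_def] L])
    show "ae_eq u w" "ae_eq v (\<lambda>x. v x - \<i> * u x + \<i> * w x)"
      using k0 unfolding ae_eq_def k_def by (eventually_elim, simp)+
  qed
qed

text \<open>The range of \<open>D_min + \<i>\<close> misses the direction \<open>e\<close>, so only
  the component of \<open>u - w\<close> orthogonal to \<open>e\<close> is shown to vanish; the
  remaining multiple of \<open>e\<close> is absorbed into the free constant of
  \<open>resolvent_fun\<close>.\<close>

lemma adjoint_D_min: "adjoint_graph D_min \<subseteq> D_max"
proof (intro subrelI)
  fix u v assume uv: "(u, v) \<in> adjoint_graph D_min"
  note L = adjoint_graphD(1,2)[OF uv]
  define h where "h = (\<lambda>x. v x - \<i> * u x)"
  have Lh: "L2 h" unfolding h_def by (intro L2_diff L2_cmult L)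
  define w where "w = resolvent_fun \<i> 0 h"
  define k where "k = (\<lambda>x. u x - w x)"
  define e where "e = g_fun \<i>"
  define c where "c = l2_inner k e / l2_inner e e" \<comment> \<open>\<open>e\<close> spans the defect space, so \<open>k = c e\<close> is to be shown\<close>
  define k' where "k' = (\<lambda>x. k x - c * e x)"
  define f where "f = resolvent_fun (- \<i>) 0 k'"
  \<comment> \<open>For \<open>\<alpha> = 0\<close> the coefficient \<open>beta_fun\<close>
    vanishes, so the bare convolution lies in \<open>D_alpha 0\<close>.\<close>
  have w: "(w, \<lambda>x. v x - \<i> * u x + \<i> * w x) \<in> D_alpha 0"
    using resolvent_alpha_mem[of \<i> h 0] Lh by (simp add: w_def h_def beta_fun_def)
  then have Lw: "L2 w" by (auto simp: D_alpha_def D_graph_def)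
  have Lk: "L2 k" unfolding k_def by (intro L2_diff L Lw)
  have Le: "L2 e" unfolding e_def by (rule L2_g_fun) simp
  have Lk': "L2 k'" unfolding k'_def by (intro L2_diff L2_cmult Lk Le)
  \<comment> \<open>Division by zero would make \<open>c\<close> equal to 0; in that case
    \<open>e\<close> vanishes almost everywhere and both sides are 0.\<close>
  have "l2_inner k e = c * l2_inner e e"
  proof (cases "l2_inner e e = 0")
    case True
    have "AE x in lborel. e x = 0" by (rule l2_inner_self_eq_0[OF Le True])
    then have "l2_inner k e = l2_inner k (\<lambda>x. 0)"
      by (intro l2_inner_cong_AE Lk Le L2_zero) (auto simp: ae_eq_def)
    then show ?thesis using True by (simp add: l2_inner_def)
  qed (simp add: c_def)
  then have k'e: "l2_inner k' e = 0"
    unfolding k'_def by (simp add: l2_inner_diff_left l2_inner_cmult_left L2_cmult Lk Le)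
  \<comment> \<open>This integral is the value of both one-sided limits of \<open>f\<close>, so
    orthogonality to \<open>e\<close> is exactly what puts \<open>f\<close> into
    \<open>D_min\<close>.\<close>
  have "(LINT y|lborel. kern (- \<i>) 0 y * k' y) = l2_inner k' e"
    by (simp add: kern_0 l2_inner_def e_def mult.commute)
  with k'e have "(f, \<lambda>x. k' x - \<i> * f x) \<in> D_min"
    using resolvent_fun_mem_D_graph[of "- \<i>" k' _ 0] Lk'
    by (simp add: f_def D_min_def resolvent_fun_lim0)
  from adjoint_defect[OF D_min_subset_D_alpha uv w this Lk'] have "l2_inner k' k = 0" by (simp add: k_def)
  then have "l2_inner k' k' = 0"
    using l2_inner_diff_right[OF Lk L2_cmult[OF Le] Lk', of c, folded k'_def] k'e
    by (simp add: l2_inner_cmult_right)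
  then have k0: "AE x in lborel. k' x = 0" by (rule l2_inner_self_eq_0[OF Lk'])
  have R: "resolvent_fun \<i> c h x = w x + c * e x" for x
    by (simp add: resolvent_fun_def w_def e_def)
  have "(resolvent_fun \<i> c h, \<lambda>x. h x + \<i> * resolvent_fun \<i> c h x) \<in> D_max"
    unfolding D_max_def by (rule resolvent_fun_mem_D_graph) (auto simp: Lh)
  then show "(u, v) \<in> D_max"
    unfolding D_max_def
  proof (rule D_graph_cong[OF _ L])
    have u_eq: "AE x in lborel. u x = resolvent_fun \<i> c h x"
      using k0 by eventually_elim (simp add: R k_def k'_def algebra_simps)
    show "ae_eq u (resolvent_fun \<i> c h)"
      using u_eq by (simp add: ae_eq_def)
    show "ae_eq v (\<lambda>x. h x + \<i> * resolvent_fun \<i> c h x)"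
      unfolding ae_eq_def using u_eq by eventually_elim (simp add: h_def)
  qed
qed

text \<open>By the product rule \<open>|\<psi>|\<^sup>2\<close> is constant on each half-line, so \<open>\<psi>\<close> vanishes everywhere off 0
  and all integrals of \<open>\<phi>\<close> over intervals avoiding 0 are zero.\<close>

lemma W21_AE_zero:
  assumes W: "W21_Omega \<psi> \<phi>" and \<psi>0: "AE x in lborel. \<psi> x = 0"
  shows "AE x in lborel. \<phi> x = 0"
proof -
  note L = W21_L2[OF W]
  have modulus: "\<psi> b * cnj (\<psi> b) = \<psi> a * cnj (\<psi> a)" if "a \<le> b" "0 < a \<or> b < 0" for a b
  proof -
    have "\<psi> b * cnj (\<psi> b) - \<psi> a * cnj (\<psi> a) =
       (LINT x:{a..b}|lborel. \<phi> x * cnj (\<psi> x) + \<psi> x * cnj (\<phi> x))"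
      using W that
      by (intro product_rule_integral(2)[symmetric] L2_set_integrable L2_cnj L)
        (auto simp: W21_Omega_iff set_integral_cnj)
    also have "\<dots> = (LINT x|(lborel::real measure). (0::complex))"
      unfolding set_lebesgue_integral_def
    proof (rule integral_cong_AE)
      show "AE x in lborel. indicat_real {a..b} x *\<^sub>R (\<phi> x * cnj (\<psi> x) + \<psi> x * cnj (\<phi> x)) = 0"
        using \<psi>0 by eventually_elim simp
      show "(\<lambda>x. indicat_real {a..b} x *\<^sub>R (\<phi> x * cnj (\<psi> x) + \<psi> x * cnj (\<phi> x))) \<in> borel_measurable lborel"
        using L[THEN L2_measurable] L[THEN L2_cnj, THEN L2_measurable] by measurable
    qed simp
    finally show ?thesis by simp
  qed
  have zero: "\<psi> x = 0" if "x \<noteq> 0" for x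
  proof -
    \<comment> \<open>The interval between \<open>x\<close> and \<open>2 * x\<close> has positive
      measure and stays on the same side of 0, so it contains a zero of
      \<open>\<psi>\<close>.\<close>
    have "\<exists>y. y * x > 0 \<and> \<psi> y = 0"
    proof (rule ccontr)
      assume no: "\<not> ?thesis"
      have "AE y in lborel. y \<notin> {min x (2 * x)..max x (2 * x)}"
        using \<psi>0
      proof eventually_elim
        case (elim y)
        then have "\<not> y * x > 0" using no by blast
        then show ?case using \<open>x \<noteq> 0\<close>
          by (auto simp: zero_less_mult_iff min_def max_def split: if_splits)
      qed
      then have "{min x (2 * x)..max x (2 * x)} \<in> null_sets lborel"
        by (subst AE_iff_null_sets) simp_all
      then have "emeasure lborel {min x (2 * x)..max x (2 * x)} = 0"
        by (rule null_setsD1)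
      then show False using \<open>x \<noteq> 0\<close> by (simp add: emeasure_lborel_Icc_eq min_def max_def split: if_splits)
    qed
    then obtain y where y: "y * x > 0" "\<psi> y = 0" by blast
    then have "\<psi> x * cnj (\<psi> x) = \<psi> y * cnj (\<psi> y)"
      using modulus[of x y] modulus[of y x] by (cases "x \<le> y") (auto simp: zero_less_mult_iff)
    then show ?thesis using y by simp
  qed
  have loc: "AE x in lborel. x \<in> {a..b} \<longrightarrow> \<phi> x = 0" if ab: "0 < a \<or> b < 0" for a b
  proof -
    define r where "r = (\<lambda>x. indicator {a..b} x *\<^sub>R \<phi> x)"
    have r: "integrable lborel r"
      using L2_set_integrable[OF L(2)] by (simp add: r_def set_integrable_def)
    have "AE x in lborel. r x = 0"
    proof (rule set_integral_atMost_zero_imp_AE_zero[OF r])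
      fix x
      have "(LINT t:{..x}|lborel. r t) = (LINT t:{a..min b x}|lborel. \<phi> t)"
        unfolding set_lebesgue_integral_def r_def
        by (intro Bochner_Integration.integral_cong) (auto simp: indicator_def)
      also have "\<dots> = 0"
      proof (cases "a \<le> min b x")
        case True
        then have "(LINT t:{a..min b x}|lborel. \<phi> t) = \<psi> (min b x) - \<psi> a"
          using W ab by (auto simp: W21_Omega_iff)
        also have "\<dots> = 0" using True ab zero[of a] zero[of "min b x"] by auto
        finally show ?thesis .
      qed (simp add: set_lebesgue_integral_def)
      finally show "(LINT t:{..x}|lborel. r t) = 0" .
    qed
    then show ?thesis by eventually_elim (auto simp: r_def)
  qed
  \<comment> \<open>Countably many compact intervals exhaust the line without 0, so the local null
    sets can be united.\<close>
  have "AE x in lborel. \<forall>n::nat. x \<in> {1 / real (Suc n)..real n} \<longrightarrow> \<phi> x = 0"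
    "AE x in lborel. \<forall>n::nat. x \<in> {- real n..- 1 / real (Suc n)} \<longrightarrow> \<phi> x = 0"
    unfolding AE_all_countable by (intro allI loc; simp)+
  moreover have "AE x in lborel. x \<noteq> (0::real)" by (rule AE_lborel_singleton)
  ultimately show ?thesis
  proof eventually_elim
    case (elim x)
    obtain n1 where n1: "inverse (real (Suc n1)) < \<bar>x\<bar>" using reals_Archimedean[of "\<bar>x\<bar>"] elim(3) by auto
    obtain n2 where n2: "\<bar>x\<bar> \<le> real n2" using real_arch_simple by blast
    define n where "n = max n1 n2"
    have "1 / real (Suc n) \<le> inverse (real (Suc n1))" by (auto simp: n_def inverse_eq_divide intro!: divide_left_mono)
    then have "1 / real (Suc n) \<le> \<bar>x\<bar>" "\<bar>x\<bar> \<le> real n" using n1 n2 by (auto simp: n_def)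
    then show ?case
      using elim(1)[rule_format, of n] elim(2)[rule_format, of n] elim(3)
      by (cases "x > 0") auto
  qed
qed

lemma W21_diff:
  assumes "W21_Omega \<psi>1 \<phi>1" "W21_Omega \<psi>2 \<phi>2"
  shows "W21_Omega (\<lambda>x. \<psi>1 x - \<psi>2 x) (\<lambda>x. \<phi>1 x - \<phi>2 x)"
  using assms by (auto simp: W21_Omega_iff set_integral_diff(2) L2_set_integrable intro!: L2_diff)

lemma D_max_single_valued:
  assumes "(f, g) \<in> D_max" "(f, g') \<in> D_max"
  shows "ae_eq g g'"
proof -
  obtain \<psi>1 \<phi>1 where 1: "W21_Omega \<psi>1 \<phi>1" "ae_eq f \<psi>1" "ae_eq g (\<lambda>x. \<i> * \<phi>1 x)"
    using assms(1) unfolding D_max_def by (elim D_graphE)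
  obtain \<psi>2 \<phi>2 where 2: "W21_Omega \<psi>2 \<phi>2" "ae_eq f \<psi>2" "ae_eq g' (\<lambda>x. \<i> * \<phi>2 x)"
    using assms(2) unfolding D_max_def by (elim D_graphE)
  have "AE x in lborel. \<psi>1 x - \<psi>2 x = 0"
    using 1(2) 2(2) unfolding ae_eq_def by eventually_elim simp
  then have "AE x in lborel. \<phi>1 x - \<phi>2 x = 0"
    by (rule W21_AE_zero[OF W21_diff[OF 1(1) 2(1)]])
  then show ?thesis
    using 1(3) 2(3) unfolding ae_eq_def by eventually_elim simp
qed

lemma self_adjoint_D_alpha: "self_adjoint (D_alpha \<alpha>)"
  unfolding self_adjoint_def using adjoint_D_alpha D_max_single_valued D_alpha_subset_D_max by blast

section \<open>Classification of the self-adjoint extensions\<close>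

text \<open>Comparing a pair with itself gives equal moduli. If some pair has \<open>m0\<close>
  nonzero, the ratio \<open>p0 / m0\<close> is unimodular, and comparison with that pair forces the
  same ratio on all others; otherwise every pair is zero.\<close>

lemma unimodular_ratio:
  fixes B :: "(complex \<times> complex) set"
  assumes B: "\<And>m p m' p'. (m, p) \<in> B \<Longrightarrow> (m', p') \<in> B \<Longrightarrow> m * cnj m' = p * cnj p'"
  shows "\<exists>\<alpha>::real. \<forall>m p. (m, p) \<in> B \<longrightarrow> p = exp (\<i> * of_real \<alpha>) * m"
proof (cases "\<exists>m p. (m, p) \<in> B \<and> m \<noteq> 0")
  case False
  have "p = exp (\<i> * of_real 0) * m" if "(m, p) \<in> B" for m p
    using B[OF that that] False that by auto
  then show ?thesis by (intro exI[of _ 0]) simp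
next
  case True
  then obtain m0 p0 where 0: "(m0, p0) \<in> B" "m0 \<noteq> 0" by blast
  have eq0: "m0 * cnj m0 = p0 * cnj p0" by (rule B[OF 0(1) 0(1)])
  then have n: "cmod p0 = cmod m0"
    by (metis complex_mod_sqrt_Re_mult_cnj)
  have "p0 \<noteq> 0" using n 0(2) by auto
  then have "exp (\<i> * of_real (Arg (p0 / m0))) = p0 / m0"
    using Arg_eq[of "p0 / m0"] n 0(2) by (simp add: norm_divide)
  then have E: "exp (\<i> * of_real (Arg (p0 / m0))) * m0 = p0" using 0(2) by simp
  have "p = exp (\<i> * of_real (Arg (p0 / m0))) * m" if "(m, p) \<in> B" for m p
  proof -
    have "p * cnj p0 = m * cnj m0" using B[OF that 0(1)] by simp
    then have "p * cnj p0 * m0 = m * (p0 * cnj p0)" using eq0 by (simp add: ac_simps)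
    then have "p * m0 = m * p0" using \<open>p0 \<noteq> 0\<close> by (simp add: ac_simps)
    also have "\<dots> = m * (exp (\<i> * of_real (Arg (p0 / m0))) * m0)" by (simp only: E)
    finally have "p * m0 = exp (\<i> * of_real (Arg (p0 / m0))) * m * m0" by (simp only: ac_simps)
    then show ?thesis using 0(2) by simp
  qed
  then show ?thesis by (intro exI[of _ "Arg (p0 / m0)"]) simp
qed

lemma self_adjoint_extension_eq_D_alpha:
  assumes A: "self_adjoint A" "D_min \<subseteq> A"
  shows "\<exists>\<alpha>. A = D_alpha \<alpha>"
proof -
  have adj: "adjoint_graph A = A" using A(1) by (simp add: self_adjoint_def)
  \<comment> \<open>Adjoints reverse inclusions, so \<open>A\<close>, being its own adjoint, lies in
    the adjoint of \<open>D_min\<close>.\<close>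
  have max: "A \<subseteq> D_max" using adjoint_graph_antimono[OF A(2)] adjoint_D_min adj by blast
  \<comment> \<open>The boundary values attained on \<open>A\<close>; symmetry of \<open>A\<close>
    makes the boundary form vanish on \<open>B\<close>.\<close>
  define B where "B = {(lim_minus0 \<psi>, lim_plus0 \<psi>) | \<psi> \<phi> f g.
    (f, g) \<in> A \<and> W21_Omega \<psi> \<phi> \<and> ae_eq f \<psi> \<and> ae_eq g (\<lambda>x. \<i> * \<phi> x)}"
  have L: "L2 f \<and> L2 g" if "(f, g) \<in> A" for f g
    using that max D_graph_L2 unfolding D_max_def by blast
  have "m * cnj m' = p * cnj p'" if B1: "(m, p) \<in> B" and B2: "(m', p') \<in> B" for m p m' p'
  proof -
    obtain \<psi>1 \<phi>1 f1 g1 where 1: "W21_Omega \<psi>1 \<phi>1" "ae_eq f1 \<psi>1" "ae_eq g1 (\<lambda>x. \<i> * \<phi>1 x)"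
      "(f1, g1) \<in> A" "m = lim_minus0 \<psi>1" "p = lim_plus0 \<psi>1" using B1 by (auto simp: B_def)
    obtain \<psi>2 \<phi>2 f2 g2 where 2: "W21_Omega \<psi>2 \<phi>2" "ae_eq f2 \<psi>2" "ae_eq g2 (\<lambda>x. \<i> * \<phi>2 x)"
      "(f2, g2) \<in> A" "m' = lim_minus0 \<psi>2" "p' = lim_plus0 \<psi>2" using B2 by (auto simp: B_def)
    have "l2_inner g1 f2 = l2_inner f1 g2"
      using adjoint_graphD(3)[of f2 g2 A f1 g1] 1(4) 2(4) adj by simp
    then show ?thesis
      using D_graph_Green[OF 1(1-3) _ _ 2(1-3)] L[OF 1(4)] L[OF 2(4)] 1(5,6) 2(5,6) by simp
  qed
  then obtain \<alpha> :: real where \<alpha>: "\<And>m p. (m, p) \<in> B \<Longrightarrow> p = exp (\<i> * of_real \<alpha>) * m"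
    using unimodular_ratio[of B] by blast
  have sub: "A \<subseteq> D_alpha \<alpha>"
  proof (intro subrelI)
    fix f g assume fg: "(f, g) \<in> A"
    then obtain \<psi> \<phi> where W: "W21_Omega \<psi> \<phi>" "ae_eq f \<psi>" "ae_eq g (\<lambda>x. \<i> * \<phi> x)"
      using max unfolding D_max_def by (blast elim: D_graphE)
    then have "(lim_minus0 \<psi>, lim_plus0 \<psi>) \<in> B" using fg by (auto simp: B_def)
    from \<alpha>[OF this] W L[OF fg] show "(f, g) \<in> D_alpha \<alpha>"
      unfolding D_alpha_def D_graph_def by blast
  qed
  \<comment> \<open>Both sides are self-adjoint, so taking adjoints turns the inclusion
    around.\<close>
  moreover have "D_alpha \<alpha> \<subseteq> A"
    using adjoint_graph_antimono[OF sub] by (simp add: adjoint_D_alpha adj)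
  ultimately show ?thesis by blast
qed

lemma cnj_beta_fun: "cnj (beta_fun (cnj z) \<alpha>) = beta_fun z \<alpha>"
  by (simp add: beta_fun_def exp_cnj algebra_simps)

theorem theorem2p1:
  shows "(\<forall>A. (self_adjoint A \<and> D_min \<subseteq> A) \<longleftrightarrow> (\<exists>\<alpha>::real. A = D_alpha \<alpha>))
    \<and> (\<forall>\<alpha>::real. 0 \<le> \<alpha> \<and> \<alpha> < 2 * pi \<longrightarrow> self_adjoint (D_alpha \<alpha>) \<and> D_min \<subseteq> D_alpha \<alpha>)
    \<and> (\<forall>\<alpha>::real. \<forall>z::complex. \<forall>h. 0 \<le> \<alpha> \<and> \<alpha> < 2 * pi \<and> Im z \<noteq> 0 \<and> L2 h \<longrightarrow>
          (\<forall>x. integrable lborel (\<lambda>y. green z \<alpha> x y * h y)) \<and>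
          (\<forall>u. (u, \<lambda>x. h x + z * u x) \<in> D_alpha \<alpha> \<longleftrightarrow>
               L2 u \<and> ae_eq u (\<lambda>x. LINT y|lborel. green z \<alpha> x y * h y)))
    \<and> (\<forall>z::complex. \<forall>\<alpha>::real. Im z \<noteq> 0 \<longrightarrow> cnj (beta_fun (cnj z) \<alpha>) = beta_fun z \<alpha>)"
proof (intro conjI allI impI)
  fix A
  show "(self_adjoint A \<and> D_min \<subseteq> A) \<longleftrightarrow> (\<exists>\<alpha>::real. A = D_alpha \<alpha>)"
    using self_adjoint_extension_eq_D_alpha self_adjoint_D_alpha D_min_subset_D_alpha by blast
next
  fix \<alpha> :: real and z :: complex and h u
  assume "0 \<le> \<alpha> \<and> \<alpha> < 2 * pi \<and> Im z \<noteq> 0 \<and> L2 h"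
  then have z: "Im z \<noteq> 0" and h: "L2 h" by auto
  show "integrable lborel (\<lambda>y. green z \<alpha> x y * h y)" for x by (rule green_integral(1)[OF z h])
  show "(u, \<lambda>x. h x + z * u x) \<in> D_alpha \<alpha> \<longleftrightarrow>
      L2 u \<and> ae_eq u (\<lambda>x. LINT y|lborel. green z \<alpha> x y * h y)"
    unfolding green_integral(2)[OF z h]
  \<comment> \<open>The forward direction is uniqueness of the solution; the converse is existence
    together with invariance of the graph under changes on null sets.\<close>
  proof
    assume "(u, \<lambda>x. h x + z * u x) \<in> D_alpha \<alpha>"
    then show "L2 u \<and> ae_eq u (\<lambda>x. resolvent_alpha z \<alpha> h x)"
      using D_alpha_resolvent_unique[OF z h] D_graph_L2 unfolding D_alpha_def by blast
  next
    assume u: "L2 u \<and> ae_eq u (\<lambda>x. resolvent_alpha z \<alpha> h x)"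
    show "(u, \<lambda>x. h x + z * u x) \<in> D_alpha \<alpha>"
      unfolding D_alpha_def
    proof (rule D_graph_cong[OF resolvent_alpha_mem[OF z h, unfolded D_alpha_def]])
      show "ae_eq (\<lambda>x. h x + z * u x) (\<lambda>x. h x + z * resolvent_alpha z \<alpha> h x)"
        using u unfolding ae_eq_def by auto
    qed (use u h in \<open>auto intro: L2_add L2_cmult\<close>)
  qed
qed (simp_all add: self_adjoint_D_alpha D_min_subset_D_alpha cnj_beta_fun)

end
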